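(* The category $\mathsf{CExt}\,\mathsf{Rck}$ of central extensions of racks is an $\mathcal E_1$-reflective subcategory of the category $\mathsf{Ext}\,\mathsf{Rck}$ of extensions of racks, with left adjoint $\mathrm F_1$ and unit $\eta^1$ defined for an object $f\colon A\to B$ of $\mathsf{Ext}\,\mathsf{Rck}$ by $\eta^1_f=(\eta^1_A,\mathrm{id}_B)$, where $\eta^1_A\colon A\to \mathrm F^i_1(A)$ is the quotient of $A$ by the centralizing congruence $\mathrm C_1(f)$, which can be defined in the following equivalent ways: (i) $\mathrm C_1(f)$ is the equivalence relation on $A$ generated by the pairs $\big((x\triangleleft a)\triangleleft^{-1}b,\;x\big)$ for $x,a,b\in A$ with $f(a)=f(b)$; (ii) a pair $(a,b)\in A\times A$ is in $\mathrm C_1(f)$ if and only if $a$ and $b$ are the endpoints of an $f$-horn, i.e. there is an $f$-horn $M=(x,(a_i,b_i,\delta_i)_{1\le i\le n})$ such that $x\cdot g^M_a=a$ and $x\cdot g^M_b=b$; (iii) $\mathrm C_1(f)$ is the orbit relation $\sim_{\mathrm{Ker}(\vec f)}$ (or equivalently $\sim_{\mathrm K_{\vec f}}$) induced by the action on $A$ of the kernel of $\vec f\colon\mathrm{Pth}(A)\to\mathrm{Pth}(B)$ (i.e. of the group of $f$-symmetric paths). Since $\mathrm C_1(f)\le\mathrm{Eq}(f)$, the image $\mathrm F_1(f)\colon \mathrm F^i_1(A)\to B$ is the unique morphism such that $\mathrm F_1(f)\circ\eta^1_A=f$. On a morphism $\alpha=(\alpha_1,\alpha_0)\colon f_A\to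 f_B$, with $f_A\colon A_1\to A_0$ and $f_B\colon B_1\to B_0$, $\mathrm F_1(\alpha)$ has top component $\mathrm F^i_1(\alpha_1)$, defined by the universal property of the quotient $\eta^1_{A_1}$ (i.e. $\mathrm F^i_1(\alpha_1)\circ\eta^1_{A_1}=\eta^1_{B_1}\circ\alpha_1$), and bottom component $\alpha_0$.
   Context: A rack is a set $X$ with two binary operations $\triangleleft,\triangleleft^{-1}$ such that $(x\triangleleft y)\triangleleft^{-1}y = x = (x\triangleleft^{-1}y)\triangleleft y$ and $(x\triangleleft y)\triangleleft z=(x\triangleleft z)\triangleleft(y\triangleleft z)$. Write $\triangleleft^{1}=\triangleleft$. $\mathsf{Rck}$ is the category of racks. An extension is a surjective morphism. $\mathsf{Ext}\,\mathsf{Rck}$ has extensions as objects; a morphism $\alpha=(\alpha_1,\alpha_0)\colon f_A\to f_B$ from $f_A\colon A_1\to A_0$ to $f_B\colon B_1\to B_0$ is a pair of rack morphisms $\alpha_1\colon A_1\to B_1$ (top), $\alpha_0\colon A_0\to B_0$ (bottom) with $f_B\alpha_1=\alpha_0f_A$. $\mathcal E_1$ is the class of double extensions: morphisms $\alpha$ with $\alpha_1$, $\alpha_0$ and the comparison map $A_1\to A_0\times_{B_0}B_1$ all surjective. $\mathcal E_1$-reflective means full, replete and reflective with all unit components in $\mathcal E_1$. $\pi_0(X)$ is the quotient of the set $X$ by the equivalence relation generated by the pairs $(x,x\triangleleft y)$, with quotient map $\eta_X$. An extension $t\colon X\to Y$ is trivial if the square $\eta_Yt=\pi_0(t)\eta_X$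 is a pullback (of racks, sets being viewed as racks with $x\triangleleft y=x$). An extension $f\colon A\to B$ is central if its pullback along some extension $E\to B$ is trivial; equivalently, $f$ is a covering: $(x\triangleleft a)\triangleleft^{-1}b=x$ whenever $f(a)=f(b)$. $\mathsf{CExt}\,\mathsf{Rck}$ is the full subcategory of $\mathsf{Ext}\,\mathsf{Rck}$ on central extensions. $\mathrm{Pth}(X)$ is the group with generators $\underline x$ ($x\in X$) and relations $\underline{x\triangleleft a}=\underline a^{-1}\underline x\,\underline a$; it acts on the right on $X$ by $x\cdot\underline y=x\triangleleft y$; $\vec f=\mathrm{Pth}(f)$ is given by $\underline x\mapsto\underline{f(x)}$. $\mathrm{Eq}(f)=\{(a,b)\mid f(a)=f(b)\}$. An $f$-horn $M=(x,(a_i,b_i,\delta_i)_{1\le i\le n})$ consists of $x\in A$, $n\in\mathbb N$, pairs $(a_i,b_i)\in\mathrm{Eq}(f)$ and $\delta_i\in\{-1,1\}$; $g^M_a=\underline{a_1}^{\delta_1}\cdots\underline{a_n}^{\delta_n}$ and $g^M_b=\underline{b_1}^{\delta_1}\cdots\underline{b_n}^{\delta_n}$ in $\mathrm{Pth}(A)$. $\mathrm K_{\vec f}$ is the group of ($\vec f$-, or) $f$-symmetric paths: the elements $g_ag_b^{-1}\in\mathrm{Pth}(A)$ with $g_a=\underline{a_1}^{\delta_1}\cdots\underline{a_n}^{\delta_n}$, $g_b=\underline{b_1}^{\delta_1}\cdots\underline{b_n}^{\delta_n}$ for some $n\in\mathbb N$, $\delta_i\in\{-1,1\}$, and $a_i,b_i\in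 A$ with $\vec f(\underline{a_i})=\vec f(\underline{b_i})$. For a subgroup $N\leq\mathrm{Pth}(A)$, $x\sim_N y$ means $y=x\cdot g$ for some $g\in N$. *)

theory Defs
  imports "HOL-Algebra.Coset"
begin

section \<open>Racks\<close>

record 'a rack = "'a partial_object" +
  rop :: "'a \<Rightarrow> 'a \<Rightarrow> 'a" (infixl \<open>\<triangleleft>\<index>\<close> 70)
  rop_inv :: "'a \<Rightarrow> 'a \<Rightarrow> 'a" (infixl \<open>\<triangleleft>\<inverse>\<index>\<close> 70)

locale rack =
  fixes X :: "'a rack" (structure)
  assumes op_closed: "x \<in> carrier X \<Longrightarrow> y \<in> carrier X \<Longrightarrow> x \<triangleleft> y \<in> carrier X"
    and inv_closed: "x \<in> carrier X \<Longrightarrow> y \<in> carrier X \<Longrightarrow> x \<triangleleft>\<inverse> y \<in> carrier X"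
    and op_inv: "x \<in> carrier X \<Longrightarrow> y \<in> carrier X \<Longrightarrow> (x \<triangleleft> y) \<triangleleft>\<inverse> y = x"
    and inv_op: "x \<in> carrier X \<Longrightarrow> y \<in> carrier X \<Longrightarrow> (x \<triangleleft>\<inverse> y) \<triangleleft> y = x"
    and self_distrib: "x \<in> carrier X \<Longrightarrow> y \<in> carrier X \<Longrightarrow> z \<in> carrier X \<Longrightarrow>
          (x \<triangleleft> y) \<triangleleft> z = (x \<triangleleft> z) \<triangleleft> (y \<triangleleft> z)"

text \<open>Morphisms are extensional functions, so that two morphisms are equal as soon as they agree on
  the carrier; accordingly they are composed with \<^const>\<open>compose\<close>.\<close>

definition rack_hom :: "'a rack \<Rightarrow> 'b rack \<Rightarrow> ('a \<Rightarrow> 'b) set" where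
  "rack_hom X Y = {f \<in> carrier X \<rightarrow>\<^sub>E carrier Y. \<forall>x \<in> carrier X. \<forall>y \<in> carrier X.
     f (x \<triangleleft>\<^bsub>X\<^esub> y) = f x \<triangleleft>\<^bsub>Y\<^esub> f y \<and> f (x \<triangleleft>\<inverse>\<^bsub>X\<^esub> y) = f x \<triangleleft>\<inverse>\<^bsub>Y\<^esub> f y}"

definition fibre_product ::
    "'a rack \<Rightarrow> 'b rack \<Rightarrow> ('a \<Rightarrow> 'c) \<Rightarrow> ('b \<Rightarrow> 'c) \<Rightarrow> ('a \<times> 'b) rack" where
  "fibre_product X Y p q =
     \<lparr>carrier = {(x, y). x \<in> carrier X \<and> y \<in> carrier Y \<and> p x = q y},
      rop = (\<lambda>(x, y) (x', y'). (x \<triangleleft>\<^bsub>X\<^esub> x', y \<triangleleft>\<^bsub>Y\<^esub> y')),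
      rop_inv = (\<lambda>(x, y) (x', y'). (x \<triangleleft>\<inverse>\<^bsub>X\<^esub> x', y \<triangleleft>\<inverse>\<^bsub>Y\<^esub> y'))\<rparr>"

definition rack_congruence :: "'a rack \<Rightarrow> ('a \<times> 'a) set \<Rightarrow> bool" where
  "rack_congruence X R \<longleftrightarrow> equiv (carrier X) R \<and>
     (\<forall>(x, x') \<in> R. \<forall>(y, y') \<in> R.
        (x \<triangleleft>\<^bsub>X\<^esub> y, x' \<triangleleft>\<^bsub>X\<^esub> y') \<in> R \<and> (x \<triangleleft>\<inverse>\<^bsub>X\<^esub> y, x' \<triangleleft>\<inverse>\<^bsub>X\<^esub> y') \<in> R)"

definition quotient_rack :: "'a rack \<Rightarrow> ('a \<times> 'a) set \<Rightarrow> 'a set rack" where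
  "quotient_rack X R =
     \<lparr>carrier = carrier X // R,
      rop = (\<lambda>C D. \<Union>x\<in>C. \<Union>y\<in>D. R `` {x \<triangleleft>\<^bsub>X\<^esub> y}),
      rop_inv = (\<lambda>C D. \<Union>x\<in>C. \<Union>y\<in>D. R `` {x \<triangleleft>\<inverse>\<^bsub>X\<^esub> y})\<rparr>"

definition quotient_map :: "'a rack \<Rightarrow> ('a \<times> 'a) set \<Rightarrow> 'a \<Rightarrow> 'a set" where
  "quotient_map X R = (\<lambda>x \<in> carrier X. R `` {x})"

definition generated_equiv :: "'a set \<Rightarrow> ('a \<times> 'a) set \<Rightarrow> ('a \<times> 'a) set" where
  "generated_equiv S P = \<Inter>{R. equiv S R \<and> P \<subseteq> R}"

section \<open>The category of extensions\<close>

record ('a, 'b) rack_arrow =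
  src :: "'a rack"
  tgt :: "'b rack"
  arr :: "'a \<Rightarrow> 'b"

definition extension :: "('a, 'b) rack_arrow \<Rightarrow> bool" where
  "extension f \<longleftrightarrow> rack (src f) \<and> rack (tgt f) \<and> arr f \<in> rack_hom (src f) (tgt f) \<and>
     arr f ` carrier (src f) = carrier (tgt f)"

definition Eq :: "('a, 'b) rack_arrow \<Rightarrow> ('a \<times> 'a) set" where
  "Eq f = {(a, b). a \<in> carrier (src f) \<and> b \<in> carrier (src f) \<and> arr f a = arr f b}"

definition ext_hom ::
    "('a, 'b) rack_arrow \<Rightarrow> ('c, 'd) rack_arrow \<Rightarrow> (('a \<Rightarrow> 'c) \<times> ('b \<Rightarrow> 'd)) set" where
  "ext_hom f g = {(\<alpha>1, \<alpha>0). \<alpha>1 \<in> rack_hom (src f) (src g) \<and> \<alpha>0 \<in> rack_hom (tgt f) (tgt g) \<and>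
     compose (carrier (src f)) (arr g) \<alpha>1 = compose (carrier (src f)) \<alpha>0 (arr f)}"

definition ext_id :: "('a, 'b) rack_arrow \<Rightarrow> ('a \<Rightarrow> 'a) \<times> ('b \<Rightarrow> 'b)" where
  "ext_id f = (\<lambda>x \<in> carrier (src f). x, \<lambda>y \<in> carrier (tgt f). y)"

text \<open>\<open>ext_comp f \<beta> \<alpha>\<close> is \<open>\<beta> \<circ> \<alpha>\<close>, for a morphism \<open>\<alpha>\<close> with domain \<open>f\<close>.\<close>

definition ext_comp ::
    "('a, 'b) rack_arrow \<Rightarrow> ('c \<Rightarrow> 'e) \<times> ('d \<Rightarrow> 'h) \<Rightarrow> ('a \<Rightarrow> 'c) \<times> ('b \<Rightarrow> 'd) \<Rightarrow>
     ('a \<Rightarrow> 'e) \<times> ('b \<Rightarrow> 'h)" where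
  "ext_comp f \<beta> \<alpha> = (compose (carrier (src f)) (fst \<beta>) (fst \<alpha>),
                     compose (carrier (tgt f)) (snd \<beta>) (snd \<alpha>))"

definition ext_isomorphic :: "('a, 'b) rack_arrow \<Rightarrow> ('c, 'd) rack_arrow \<Rightarrow> bool" where
  "ext_isomorphic f g \<longleftrightarrow> (\<exists>\<alpha> \<in> ext_hom f g. \<exists>\<beta> \<in> ext_hom g f.
     ext_comp f \<beta> \<alpha> = ext_id f \<and> ext_comp g \<alpha> \<beta> = ext_id g)"

definition double_extension ::
    "('a, 'b) rack_arrow \<Rightarrow> ('c, 'd) rack_arrow \<Rightarrow> ('a \<Rightarrow> 'c) \<times> ('b \<Rightarrow> 'd) \<Rightarrow> bool" where
  "double_extension f g \<alpha> \<longleftrightarrow> \<alpha> \<in> ext_hom f g \<and>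
     fst \<alpha> ` carrier (src f) = carrier (src g) \<and> snd \<alpha> ` carrier (tgt f) = carrier (tgt g) \<and>
     (\<lambda>a. (arr f a, fst \<alpha> a)) ` carrier (src f)
       = carrier (fibre_product (tgt f) (src g) (snd \<alpha>) (arr g))"

section \<open>Connected components, trivial and central extensions\<close>

definition pi0_rel :: "'a rack \<Rightarrow> ('a \<times> 'a) set" where
  "pi0_rel X = generated_equiv (carrier X)
     {(x, x \<triangleleft>\<^bsub>X\<^esub> y) | x y. x \<in> carrier X \<and> y \<in> carrier X}"

definition pi0 :: "'a rack \<Rightarrow> 'a set rack" where
  "pi0 X = \<lparr>carrier = carrier X // pi0_rel X, rop = (\<lambda>C D. C), rop_inv = (\<lambda>C D. C)\<rparr>"

definition pi0_unit :: "'a rack \<Rightarrow> 'a \<Rightarrow> 'a set" where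
  "pi0_unit X = quotient_map X (pi0_rel X)"

definition pi0_map :: "('a, 'b) rack_arrow \<Rightarrow> 'a set \<Rightarrow> 'b set" where
  "pi0_map t = (\<lambda>C \<in> carrier (pi0 (src t)). pi0_rel (tgt t) `` (arr t ` C))"

text \<open>A commutative square \<open>q \<circ> u = r \<circ> v\<close> of racks is a pullback if the comparison map to the
  fibre product (a morphism) is bijective.\<close>

definition pullback_square ::
    "'a rack \<Rightarrow> 'b rack \<Rightarrow> 'c rack \<Rightarrow> ('a \<Rightarrow> 'b) \<Rightarrow> ('a \<Rightarrow> 'c) \<Rightarrow> ('b \<Rightarrow> 'd) \<Rightarrow> ('c \<Rightarrow> 'd) \<Rightarrow> bool" where
  "pullback_square P Y Z u v q r \<longleftrightarrow>
     (\<forall>x \<in> carrier P. q (u x) = r (v x)) \<and>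
     bij_betw (\<lambda>x. (u x, v x)) (carrier P) (carrier (fibre_product Y Z q r))"

definition trivial_extension :: "('a, 'b) rack_arrow \<Rightarrow> bool" where
  "trivial_extension t \<longleftrightarrow> extension t \<and>
     pullback_square (src t) (tgt t) (pi0 (src t))
       (arr t) (pi0_unit (src t)) (pi0_unit (tgt t)) (pi0_map t)"

definition pullback_along ::
    "('e, 'b) rack_arrow \<Rightarrow> ('a, 'b) rack_arrow \<Rightarrow> ('e \<times> 'a, 'e) rack_arrow" where
  "pullback_along p f =
     (let P = fibre_product (src p) (src f) (arr p) (arr f)
      in \<lparr>src = P, tgt = src p, arr = restrict fst (carrier P)\<rparr>)"

text \<open>The definition of centrality quantifies over all extensions of the codomain. HOL has no
  quantifier over types, so the carrier of the extension \<open>p\<close> is taken in one fixed type, which is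
  large enough to hold the free rack on the codomain; \<open>central_if_trivial_pullback\<close> below shows
  that extensions on any other type would give the same notion.\<close>

definition central :: "('a, 'b) rack_arrow \<Rightarrow> bool" where
  "central f \<longleftrightarrow> extension f \<and>
     (\<exists>p :: ('b \<times> ('b \<times> bool) list set, 'b) rack_arrow.
        extension p \<and> tgt p = tgt f \<and> trivial_extension (pullback_along p f))"

section \<open>The group of paths\<close>

text \<open>Words over \<open>S\<close> are lists of letters \<open>(s, True)\<close> and \<open>(s, False)\<close>, which stand for
  \<open>s\<close> and its formal inverse. \<open>word_equiv S R\<close> is the congruence on words
  presenting the group with generators \<open>S\<close> and relations \<open>u = v\<close> for \<open>(u, v) \<in> R\<close>.\<close>

inductive_set word_equiv ::
    "'a set \<Rightarrow> (('a \<times> bool) list \<times> ('a \<times> bool) list) set \<Rightarrow>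
     (('a \<times> bool) list \<times> ('a \<times> bool) list) set"
  for S R where
  refl: "w \<in> lists (S \<times> UNIV) \<Longrightarrow> (w, w) \<in> word_equiv S R"
| sym: "(u, v) \<in> word_equiv S R \<Longrightarrow> (v, u) \<in> word_equiv S R"
| trans: "(u, v) \<in> word_equiv S R \<Longrightarrow> (v, w) \<in> word_equiv S R \<Longrightarrow> (u, w) \<in> word_equiv S R"
| append: "(u, u') \<in> word_equiv S R \<Longrightarrow> (v, v') \<in> word_equiv S R \<Longrightarrow>
           (u @ v, u' @ v') \<in> word_equiv S R"
| cancel: "s \<in> S \<Longrightarrow> ([(s, e), (s, \<not> e)], []) \<in> word_equiv S R"
| relation: "(u, v) \<in> R \<Longrightarrow> u \<in> lists (S \<times> UNIV) \<Longrightarrow> v \<in> lists (S \<times> UNIV) \<Longrightarrow>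
           (u, v) \<in> word_equiv S R"

definition path_equiv :: "'a rack \<Rightarrow> (('a \<times> bool) list \<times> ('a \<times> bool) list) set" where
  "path_equiv X = word_equiv (carrier X)
     {([(x \<triangleleft>\<^bsub>X\<^esub> a, True)], [(a, False), (x, True), (a, True)]) | x a.
        x \<in> carrier X \<and> a \<in> carrier X}"

definition words :: "'a rack \<Rightarrow> ('a \<times> bool) list set" where
  "words X = lists (carrier X \<times> UNIV)"

definition Pth :: "'a rack \<Rightarrow> ('a \<times> bool) list set monoid" where
  "Pth X =
     \<lparr>carrier = words X // path_equiv X,
      mult = (\<lambda>C D. \<Union>u\<in>C. \<Union>v\<in>D. path_equiv X `` {u @ v}),
      one = path_equiv X `` {[]}\<rparr>"

definition path_gen :: "'a rack \<Rightarrow> 'a \<Rightarrow> ('a \<times> bool) list set" where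
  "path_gen X x = path_equiv X `` {[(x, True)]}"

definition Pth_map :: "('a, 'b) rack_arrow \<Rightarrow> ('a \<times> bool) list set \<Rightarrow> ('b \<times> bool) list set" where
  "Pth_map f = (\<lambda>C \<in> carrier (Pth (src f)).
     \<Union>w\<in>C. path_equiv (tgt f) `` {map (map_prod (arr f) id) w})"

definition word_act :: "'a rack \<Rightarrow> 'a \<Rightarrow> ('a \<times> bool) list \<Rightarrow> 'a" where
  "word_act X = foldl (\<lambda>x (y, e). if e then x \<triangleleft>\<^bsub>X\<^esub> y else x \<triangleleft>\<inverse>\<^bsub>X\<^esub> y)"

text \<open>All words in an element of \<open>Pth X\<close> act in the same way, so the image set
  below is a singleton.\<close>

definition path_act :: "'a rack \<Rightarrow> 'a \<Rightarrow> ('a \<times> bool) list set \<Rightarrow> 'a" where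
  "path_act X x g = the_elem (word_act X x ` g)"

definition orbit_rel :: "'a rack \<Rightarrow> ('a \<times> bool) list set set \<Rightarrow> ('a \<times> 'a) set" where
  "orbit_rel X N = {(x, y). x \<in> carrier X \<and> y \<in> carrier X \<and> (\<exists>g\<in>N. y = path_act X x g)}"

definition path_prod :: "'a rack \<Rightarrow> ('a \<times> int) list \<Rightarrow> ('a \<times> bool) list set" where
  "path_prod X L =
     foldr (\<lambda>(a, d) g. (path_gen X a [^]\<^bsub>Pth X\<^esub> d) \<otimes>\<^bsub>Pth X\<^esub> g) L \<one>\<^bsub>Pth X\<^esub>"

text \<open>For \<open>M = [(a\<^sub>1, b\<^sub>1, \<delta>\<^sub>1), \<dots>, (a\<^sub>n, b\<^sub>n, \<delta>\<^sub>n)]\<close> these are \<open>g\<^sub>a\<close> and \<open>g\<^sub>b\<close>.\<close>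

definition left_path :: "'a rack \<Rightarrow> ('a \<times> 'a \<times> int) list \<Rightarrow> ('a \<times> bool) list set" where
  "left_path X M = path_prod X (map (\<lambda>(a, b, d). (a, d)) M)"

definition right_path :: "'a rack \<Rightarrow> ('a \<times> 'a \<times> int) list \<Rightarrow> ('a \<times> bool) list set" where
  "right_path X M = path_prod X (map (\<lambda>(a, b, d). (b, d)) M)"

definition is_horn :: "('a, 'b) rack_arrow \<Rightarrow> 'a \<times> ('a \<times> 'a \<times> int) list \<Rightarrow> bool" where
  "is_horn f = (\<lambda>(x, M). x \<in> carrier (src f) \<and>
     (\<forall>(a, b, d) \<in> set M. (a, b) \<in> Eq f \<and> d \<in> {-1, 1}))"

definition symmetric_paths :: "('a, 'b) rack_arrow \<Rightarrow> ('a \<times> bool) list set set" where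
  "symmetric_paths f =
     {left_path (src f) M \<otimes>\<^bsub>Pth (src f)\<^esub> inv\<^bsub>Pth (src f)\<^esub> right_path (src f) M | M.
        \<forall>(a, b, d) \<in> set M. a \<in> carrier (src f) \<and> b \<in> carrier (src f) \<and> d \<in> {-1, 1} \<and>
          Pth_map f (path_gen (src f) a) = Pth_map f (path_gen (src f) b)}"

section \<open>The centralization of an extension\<close>

definition C1 :: "('a, 'b) rack_arrow \<Rightarrow> ('a \<times> 'a) set" where
  "C1 f = generated_equiv (carrier (src f))
     {((x \<triangleleft>\<^bsub>src f\<^esub> a) \<triangleleft>\<inverse>\<^bsub>src f\<^esub> b, x) | x a b. x \<in> carrier (src f) \<and> (a, b) \<in> Eq f}"

definition F1i :: "('a, 'b) rack_arrow \<Rightarrow> 'a set rack" where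
  "F1i f = quotient_rack (src f) (C1 f)"

definition eta1_top :: "('a, 'b) rack_arrow \<Rightarrow> 'a \<Rightarrow> 'a set" where
  "eta1_top f = quotient_map (src f) (C1 f)"

definition F1 :: "('a, 'b) rack_arrow \<Rightarrow> ('a set, 'b) rack_arrow" where
  "F1 f =
     \<lparr>src = F1i f, tgt = tgt f,
      arr = (THE h. h \<in> rack_hom (F1i f) (tgt f) \<and>
                    compose (carrier (src f)) h (eta1_top f) = arr f)\<rparr>"

definition eta1 :: "('a, 'b) rack_arrow \<Rightarrow> ('a \<Rightarrow> 'a set) \<times> ('b \<Rightarrow> 'b)" where
  "eta1 f = (eta1_top f, \<lambda>y \<in> carrier (tgt f). y)"

definition F1i_map ::
    "('a, 'b) rack_arrow \<Rightarrow> ('c, 'd) rack_arrow \<Rightarrow> ('a \<Rightarrow> 'c) \<Rightarrow> 'a set \<Rightarrow> 'c set" where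
  "F1i_map f g \<alpha>1 = (THE h. h \<in> rack_hom (F1i f) (F1i g) \<and>
     compose (carrier (src f)) h (eta1_top f) = compose (carrier (src f)) (eta1_top g) \<alpha>1)"

definition F1_map ::
    "('a, 'b) rack_arrow \<Rightarrow> ('c, 'd) rack_arrow \<Rightarrow> ('a \<Rightarrow> 'c) \<times> ('b \<Rightarrow> 'd) \<Rightarrow>
     ('a set \<Rightarrow> 'c set) \<times> ('b \<Rightarrow> 'd)" where
  "F1_map f g \<alpha> = (F1i_map f g (fst \<alpha>), snd \<alpha>)"

section \<open>Central extensions are coverings; independence of \<open>central\<close> of the type of \<open>p\<close>\<close>

lemma generated_equiv_equiv: "P \<subseteq> S \<times> S \<Longrightarrow> equiv S (generated_equiv S P)"
proof -
  assume P: "P \<subseteq> S \<times> S"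
  have "equiv S (S \<times> S)" by (auto simp: equiv_def refl_on_def sym_def trans_def)
  then have "generated_equiv S P \<subseteq> S \<times> S"
    using P unfolding generated_equiv_def by (intro Inter_lower) simp
  moreover have "refl_on S (generated_equiv S P)"
    unfolding generated_equiv_def by (intro refl_onI) (auto simp: equiv_def refl_on_def)
  moreover have "sym (generated_equiv S P)"
    unfolding generated_equiv_def by (intro symI) (auto simp: equiv_def dest: symD)
  moreover have "trans (generated_equiv S P)"
  proof (rule transI)
    fix x y z assume "(x, y) \<in> generated_equiv S P" "(y, z) \<in> generated_equiv S P"
    then have "(x, z) \<in> R" if "equiv S R \<and> P \<subseteq> R" for R
      using that unfolding generated_equiv_def by (auto simp: equiv_def dest: transD)
    then show "(x, z) \<in> generated_equiv S P" unfolding generated_equiv_def by blast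
  qed
  ultimately show ?thesis by (simp add: equiv_def)
qed

lemma generated_equiv_least: "equiv S R \<Longrightarrow> P \<subseteq> R \<Longrightarrow> generated_equiv S P \<subseteq> R"
  by (auto simp: generated_equiv_def)

lemma generated_equiv_base: "P \<subseteq> generated_equiv S P"
  by (auto simp: generated_equiv_def)

lemma pi0_rel_equiv: "rack X \<Longrightarrow> equiv (carrier X) (pi0_rel X)"
  unfolding pi0_rel_def by (rule generated_equiv_equiv) (auto intro: rack.op_closed)

lemma pi0_rel_step: "x \<in> carrier X \<Longrightarrow> y \<in> carrier X \<Longrightarrow> (x, x \<triangleleft>\<^bsub>X\<^esub> y) \<in> pi0_rel X"
  unfolding pi0_rel_def by (rule set_mp[OF generated_equiv_base]) blast

lemma rack_hom_closed: "f \<in> rack_hom X Y \<Longrightarrow> x \<in> carrier X \<Longrightarrow> f x \<in> carrier Y"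
  by (auto simp: rack_hom_def)

lemma rack_hom_op: "f \<in> rack_hom X Y \<Longrightarrow> x \<in> carrier X \<Longrightarrow> y \<in> carrier X \<Longrightarrow>
   f (x \<triangleleft>\<^bsub>X\<^esub> y) = f x \<triangleleft>\<^bsub>Y\<^esub> f y"
  by (auto simp: rack_hom_def)

lemma rack_hom_inv: "f \<in> rack_hom X Y \<Longrightarrow> x \<in> carrier X \<Longrightarrow> y \<in> carrier X \<Longrightarrow>
   f (x \<triangleleft>\<inverse>\<^bsub>X\<^esub> y) = f x \<triangleleft>\<inverse>\<^bsub>Y\<^esub> f y"
  by (auto simp: rack_hom_def)

lemma equiv_sym_on: "equiv S R \<Longrightarrow> sym R" and equiv_trans_on: "equiv S R \<Longrightarrow> trans R"
  by (simp_all add: equiv_def)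

lemma equiv_sub: "equiv S R \<Longrightarrow> (x, y) \<in> R \<Longrightarrow> x \<in> S \<and> y \<in> S"
  by (auto simp: equiv_def)

lemma pi0_rel_map:
  assumes "extension t" "(x, x') \<in> pi0_rel (src t)"
  shows "(arr t x, arr t x') \<in> pi0_rel (tgt t)"
proof -
  let ?R = "{(x, x'). x \<in> carrier (src t) \<and> x' \<in> carrier (src t) \<and> (arr t x, arr t x') \<in> pi0_rel (tgt t)}"
  have h: "arr t \<in> rack_hom (src t) (tgt t)" and X: "rack (src t)" and Y: "rack (tgt t)"
    using assms(1) by (auto simp: extension_def)
  have e: "equiv (carrier (tgt t)) (pi0_rel (tgt t))" by (rule pi0_rel_equiv[OF Y])
  have "equiv (carrier (src t)) ?R"
    unfolding equiv_def
  proof (intro conjI)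
    show "refl_on (carrier (src t)) ?R"
      using e rack_hom_closed[OF h] by (auto simp: refl_on_def equiv_def)
    show "sym ?R" using e unfolding equiv_def sym_def by blast
    show "trans ?R"
    proof (rule transI)
      fix a b c assume "(a, b) \<in> ?R" "(b, c) \<in> ?R"
      then show "(a, c) \<in> ?R" using e unfolding equiv_def by (auto dest: transD)
    qed
  qed auto
  moreover have "{(x, x \<triangleleft>\<^bsub>src t\<^esub> y) | x y. x \<in> carrier (src t) \<and> y \<in> carrier (src t)} \<subseteq> ?R"
    by (auto simp: rack_hom_op[OF h] intro!: pi0_rel_step rack_hom_closed[OF h] rack.op_closed[OF X])
  ultimately have "pi0_rel (src t) \<subseteq> ?R" unfolding pi0_rel_def[of "src t"] by (rule generated_equiv_least)
  then show ?thesis using assms(2) by blast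
qed

lemma pi0_lift:
  assumes t: "extension t" and yy: "(y, y') \<in> pi0_rel (tgt t)"
  shows "(\<forall>x \<in> carrier (src t). arr t x = y \<longrightarrow> (\<exists>x' \<in> carrier (src t). arr t x' = y' \<and> (x, x') \<in> pi0_rel (src t))) \<and>
    (\<forall>x \<in> carrier (src t). arr t x = y' \<longrightarrow> (\<exists>x' \<in> carrier (src t). arr t x' = y \<and> (x, x') \<in> pi0_rel (src t)))"
proof -
  let ?L = "\<lambda>y y'. \<forall>x \<in> carrier (src t). arr t x = y \<longrightarrow> (\<exists>x' \<in> carrier (src t). arr t x' = y' \<and> (x, x') \<in> pi0_rel (src t))"
  let ?R = "{(y, y'). y \<in> carrier (tgt t) \<and> y' \<in> carrier (tgt t) \<and> ?L y y' \<and> ?L y' y}"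
  have h: "arr t \<in> rack_hom (src t) (tgt t)" and X: "rack (src t)" and Y: "rack (tgt t)"
    and s: "arr t ` carrier (src t) = carrier (tgt t)"
    using t by (auto simp: extension_def)
  have e: "equiv (carrier (src t)) (pi0_rel (src t))" by (rule pi0_rel_equiv[OF X])
  have r: "\<And>x. x \<in> carrier (src t) \<Longrightarrow> (x,x) \<in> pi0_rel (src t)"
    using e by (auto simp: equiv_def refl_on_def)
  have tr: "\<And>x y z. (x,y) \<in> pi0_rel (src t) \<Longrightarrow> (y,z) \<in> pi0_rel (src t) \<Longrightarrow> (x,z) \<in> pi0_rel (src t)"
    using equiv_trans_on[OF e] by (rule transD)
  have sy: "\<And>x y. (x,y) \<in> pi0_rel (src t) \<Longrightarrow> (y,x) \<in> pi0_rel (src t)"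
    using equiv_sym_on[OF e] by (rule symD)
  have LT: "?L a c" if "?L a b" "?L b c" for a b c
  proof (intro ballI impI)
    fix x assume x: "x \<in> carrier (src t)" "arr t x = a"
    from mp[OF bspec[OF that(1) x(1)] x(2)]
    obtain x' where x': "x' \<in> carrier (src t)" "arr t x' = b" "(x, x') \<in> pi0_rel (src t)"
      by (elim bexE conjE)
    from mp[OF bspec[OF that(2) x'(1)] x'(2)]
    obtain x'' where x'': "x'' \<in> carrier (src t)" "arr t x'' = c" "(x', x'') \<in> pi0_rel (src t)"
      by (elim bexE conjE)
    show "\<exists>x'\<in>carrier (src t). arr t x' = c \<and> (x, x') \<in> pi0_rel (src t)"
      by (intro bexI[OF _ x''(1)] conjI x''(2) tr[OF x'(3) x''(3)])
  qed
  have "equiv (carrier (tgt t)) ?R"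
    unfolding equiv_def
  proof (intro conjI)
    show "refl_on (carrier (tgt t)) ?R" using r by (auto simp: refl_on_def)
    show "sym ?R" by (auto simp: sym_def)
    show "trans ?R"
    proof (rule transI)
      fix a b c assume "(a,b) \<in> ?R" "(b,c) \<in> ?R"
      then show "(a,c) \<in> ?R" using LT[of a b c] LT[of c b a] by simp
    qed
  qed auto
  moreover have "{(x, x \<triangleleft>\<^bsub>tgt t\<^esub> y) | x y. x \<in> carrier (tgt t) \<and> y \<in> carrier (tgt t)} \<subseteq> ?R"
  proof (rule subsetI)
    fix z assume "z \<in> {(x, x \<triangleleft>\<^bsub>tgt t\<^esub> y) | x y. x \<in> carrier (tgt t) \<and> y \<in> carrier (tgt t)}"
    then obtain u v where z: "z = (u, u \<triangleleft>\<^bsub>tgt t\<^esub> v)" and uv: "u \<in> carrier (tgt t)" "v \<in> carrier (tgt t)"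
      by blast
    obtain c where c: "c \<in> carrier (src t)" "arr t c = v" using uv(2) s by (metis imageE)
    have 1: "?L u (u \<triangleleft>\<^bsub>tgt t\<^esub> v)"
    proof (intro ballI impI)
      fix x assume x: "x \<in> carrier (src t)" "arr t x = u"
      show "\<exists>x'\<in>carrier (src t). arr t x' = u \<triangleleft>\<^bsub>tgt t\<^esub> v \<and> (x, x') \<in> pi0_rel (src t)"
        using x c pi0_rel_step[OF x(1) c(1)] rack.op_closed[OF X x(1) c(1)] rack_hom_op[OF h x(1) c(1)]
        by (intro bexI[of _ "x \<triangleleft>\<^bsub>src t\<^esub> c"]) simp_all
    qed
    have 2: "?L (u \<triangleleft>\<^bsub>tgt t\<^esub> v) u"
    proof (intro ballI impI)
      fix x assume x: "x \<in> carrier (src t)" "arr t x = u \<triangleleft>\<^bsub>tgt t\<^esub> v"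
      let ?x = "x \<triangleleft>\<inverse>\<^bsub>src t\<^esub> c"
      have "?x \<in> carrier (src t)" by (rule rack.inv_closed[OF X x(1) c(1)])
      moreover have "arr t ?x = u" using rack_hom_inv[OF h x(1) c(1)] x(2) c(2) rack.op_inv[OF Y uv] by simp
      moreover have "(x, ?x) \<in> pi0_rel (src t)"
        using sy[OF pi0_rel_step[OF rack.inv_closed[OF X x(1) c(1)] c(1)]] rack.inv_op[OF X x(1) c(1)]
        by simp
      ultimately show "\<exists>x'\<in>carrier (src t). arr t x' = u \<and> (x, x') \<in> pi0_rel (src t)"
        by (intro bexI[of _ ?x] conjI)
    qed
    show "z \<in> ?R"
      unfolding z mem_Collect_eq case_prod_conv
      by (intro conjI uv rack.op_closed[OF Y uv] 1 2)
  qed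
  ultimately have "pi0_rel (tgt t) \<subseteq> ?R" unfolding pi0_rel_def[of "tgt t"] by (rule generated_equiv_least)
  then show ?thesis using yy by blast
qed

lemma pi0_map_class:
  assumes t: "extension t" and x: "x \<in> carrier (src t)"
  shows "pi0_map t (pi0_rel (src t) `` {x}) = pi0_rel (tgt t) `` {arr t x}"
proof -
  have X: "rack (src t)" and Y: "rack (tgt t)" using t by (auto simp: extension_def)
  have e: "equiv (carrier (src t)) (pi0_rel (src t))" by (rule pi0_rel_equiv[OF X])
  have e': "equiv (carrier (tgt t)) (pi0_rel (tgt t))" by (rule pi0_rel_equiv[OF Y])
  have "pi0_rel (src t) `` {x} \<in> carrier (pi0 (src t))" using x by (auto simp: pi0_def quotientI)
  moreover have "pi0_rel (tgt t) `` (arr t ` (pi0_rel (src t) `` {x})) = pi0_rel (tgt t) `` {arr t x}"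
  proof (intro equalityI subsetI)
    fix z assume "z \<in> pi0_rel (tgt t) `` (arr t ` (pi0_rel (src t) `` {x}))"
    then obtain x' where x': "(x, x') \<in> pi0_rel (src t)" "(arr t x', z) \<in> pi0_rel (tgt t)" by auto
    then have "(arr t x, z) \<in> pi0_rel (tgt t)"
      using pi0_rel_map[OF t x'(1)] e' unfolding equiv_def trans_def by meson
    then show "z \<in> pi0_rel (tgt t) `` {arr t x}" by simp
  next
    fix z assume "z \<in> pi0_rel (tgt t) `` {arr t x}"
    then show "z \<in> pi0_rel (tgt t) `` (arr t ` (pi0_rel (src t) `` {x}))"
      using equiv_class_self[OF e x] by auto
  qed
  ultimately show ?thesis by (simp add: pi0_map_def)
qed

lemma trivial_extension_iff:
  assumes t: "extension t"
  shows "trivial_extension t \<longleftrightarrow> (\<forall>x x'. (x, x') \<in> pi0_rel (src t) \<and> arr t x = arr t x' \<longrightarrow> x = x')"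
proof -
  have h: "arr t \<in> rack_hom (src t) (tgt t)" and X: "rack (src t)" and Y: "rack (tgt t)"
    using t by (auto simp: extension_def)
  have e: "equiv (carrier (src t)) (pi0_rel (src t))" by (rule pi0_rel_equiv[OF X])
  have e': "equiv (carrier (tgt t)) (pi0_rel (tgt t))" by (rule pi0_rel_equiv[OF Y])
  let ?c = "\<lambda>x. (arr t x, pi0_unit (src t) x)"
  have com: "pi0_unit (tgt t) (arr t x) = pi0_map t (pi0_unit (src t) x)" if "x \<in> carrier (src t)" for x
    using that pi0_map_class[OF t] rack_hom_closed[OF h] by (simp add: pi0_unit_def quotient_map_def)
  have im: "?c ` carrier (src t) = carrier (fibre_product (tgt t) (pi0 (src t)) (pi0_unit (tgt t)) (pi0_map t))"
  proof (intro equalityI subsetI)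
    fix z assume "z \<in> ?c ` carrier (src t)"
    then show "z \<in> carrier (fibre_product (tgt t) (pi0 (src t)) (pi0_unit (tgt t)) (pi0_map t))"
      using com rack_hom_closed[OF h]
      by (auto simp: fibre_product_def pi0_def pi0_unit_def quotient_map_def quotientI)
  next
    fix z assume z: "z \<in> carrier (fibre_product (tgt t) (pi0 (src t)) (pi0_unit (tgt t)) (pi0_map t))"
    then obtain y x where zz: "z = (y, pi0_rel (src t) `` {x})" "y \<in> carrier (tgt t)" "x \<in> carrier (src t)"
      "pi0_unit (tgt t) y = pi0_map t (pi0_rel (src t) `` {x})"
      by (auto simp: fibre_product_def pi0_def elim!: quotientE)
    then have "pi0_rel (tgt t) `` {y} = pi0_rel (tgt t) `` {arr t x}"
      using pi0_map_class[OF t] by (simp add: pi0_unit_def quotient_map_def)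
    then have "(arr t x, y) \<in> pi0_rel (tgt t)"
      using e' zz rack_hom_closed[OF h] by (metis eq_equiv_class)
    then obtain x' where x': "x' \<in> carrier (src t)" "arr t x' = y" "(x, x') \<in> pi0_rel (src t)"
      using pi0_lift[OF t] zz by blast
    then have "z = ?c x'" using zz equiv_class_eq[OF e]
      by (auto simp: pi0_unit_def quotient_map_def)
    then show "z \<in> ?c ` carrier (src t)" using x' by auto
  qed
  have "inj_on ?c (carrier (src t)) \<longleftrightarrow> (\<forall>x x'. (x, x') \<in> pi0_rel (src t) \<and> arr t x = arr t x' \<longrightarrow> x = x')"
    (is "?l = ?r")
  proof
    assume l: ?l
    show ?r
    proof (intro allI impI)
      fix x x' assume a: "(x, x') \<in> pi0_rel (src t) \<and> arr t x = arr t x'"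
      have "?c x = ?c x'" using a equiv_class_eq[OF e] equiv_sub[OF e]
        by (auto simp: pi0_unit_def quotient_map_def)
      then show "x = x'" using l a equiv_sub[OF e] unfolding inj_on_def by blast
    qed
  next
    assume r: ?r
    show ?l
    proof (rule inj_onI)
      fix x x' assume a: "x \<in> carrier (src t)" "x' \<in> carrier (src t)" "?c x = ?c x'"
      then have "(x, x') \<in> pi0_rel (src t)" using eq_equiv_class[OF _ e]
        by (auto simp: pi0_unit_def quotient_map_def)
      then show "x = x'" using r a by auto
    qed
  qed
  then show ?thesis using com im t
    by (auto simp: trivial_extension_def pullback_square_def bij_betw_def)
qed

definition covering :: "('a, 'b) rack_arrow \<Rightarrow> bool" where
  "covering f \<longleftrightarrow> extension f \<and>
     (\<forall>x \<in> carrier (src f). \<forall>(a, b) \<in> Eq f. (x \<triangleleft>\<^bsub>src f\<^esub> a) \<triangleleft>\<inverse>\<^bsub>src f\<^esub> b = x)"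

lemma pullback_along_extension:
  assumes p: "extension p" and f: "extension f" and e: "tgt p = tgt f"
  shows "extension (pullback_along p f)"
proof -
  have hp: "arr p \<in> rack_hom (src p) (tgt p)" and P: "rack (src p)"
    using p by (auto simp: extension_def)
  have h: "arr f \<in> rack_hom (src f) (tgt f)" and A: "rack (src f)"
     and s: "arr f ` carrier (src f) = carrier (tgt f)"
    using f by (auto simp: extension_def)
  let ?P = "fibre_product (src p) (src f) (arr p) (arr f)"
  note cl = rack.op_closed[OF P] rack.op_closed[OF A] rack.inv_closed[OF P] rack.inv_closed[OF A]
  have 1: "rack ?P"
    by (unfold_locales)
      (auto simp: fibre_product_def cl rack_hom_op[OF hp] rack_hom_op[OF h] rack_hom_inv[OF hp] rack_hom_inv[OF h] e
         rack.op_inv[OF P] rack.op_inv[OF A] rack.inv_op[OF P] rack.inv_op[OF A]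
         intro: rack.self_distrib[OF P] rack.self_distrib[OF A])
  have 2: "restrict fst (carrier ?P) \<in> rack_hom ?P (src p)"
    using rack.op_closed[OF 1] rack.inv_closed[OF 1]
    unfolding rack_hom_def by (auto simp: fibre_product_def)
  have 3: "restrict fst (carrier ?P) ` carrier ?P = carrier (src p)"
  proof -
    have "u \<in> fst ` carrier ?P" if u: "u \<in> carrier (src p)" for u
    proof -
      have "arr p u \<in> arr f ` carrier (src f)" using s e rack_hom_closed[OF hp u] by simp
      then obtain a where "a \<in> carrier (src f)" "arr f a = arr p u" by auto
      then have "(u, a) \<in> carrier ?P" using u by (simp add: fibre_product_def)
      then show ?thesis by (metis fst_conv image_eqI)
    qed
    then show ?thesis by (auto simp: fibre_product_def)
  qed
  show ?thesis using 1 2 3 P unfolding extension_def pullback_along_def Let_def by simp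
qed

lemma covering_if_trivial_pullback:
  assumes p: "extension p" and f: "extension f" and e: "tgt p = tgt f"
    and t: "trivial_extension (pullback_along p f)"
  shows "covering f"
  unfolding covering_def
proof (intro conjI f ballI, clarify)
  fix x a b assume x: "x \<in> carrier (src f)" and ab: "(a, b) \<in> Eq f"
  have hp: "arr p \<in> rack_hom (src p) (tgt p)" and P: "rack (src p)"
     and sp: "arr p ` carrier (src p) = carrier (tgt p)"
    using p by (auto simp: extension_def)
  have h: "arr f \<in> rack_hom (src f) (tgt f)" and A: "rack (src f)"
    using f by (auto simp: extension_def)
  let ?P = "fibre_product (src p) (src f) (arr p) (arr f)"
  have ex: "extension (pullback_along p f)" by (rule pullback_along_extension[OF p f e])
  have sr: "src (pullback_along p f) = ?P" by (simp add: pullback_along_def Let_def)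
  have rP: "rack ?P" using ex sr by (auto simp: extension_def)
  have a: "a \<in> carrier (src f)" "b \<in> carrier (src f)" "arr f a = arr f b" using ab by (auto simp: Eq_def)
  obtain u where u: "u \<in> carrier (src p)" "arr p u = arr f x"
    using x sp e rack_hom_closed[OF h x] by (metis imageE)
  obtain c where c: "c \<in> carrier (src p)" "arr p c = arr f a"
    using a sp e rack_hom_closed[OF h a(1)] by (metis imageE)
  have m: "(u,x) \<in> carrier ?P" "(c,a) \<in> carrier ?P" "(c,b) \<in> carrier ?P"
    using x a u c by (auto simp: fibre_product_def)
  let ?y = "(u,x) \<triangleleft>\<^bsub>?P\<^esub> (c,a)" let ?z = "?y \<triangleleft>\<inverse>\<^bsub>?P\<^esub> (c,b)"
  have y: "?y \<in> carrier ?P" and z: "?z \<in> carrier ?P"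
    using m rack.op_closed[OF rP] rack.inv_closed[OF rP] by metis+
  have e0: "equiv (carrier ?P) (pi0_rel ?P)" by (rule pi0_rel_equiv[OF rP])
  have "((u,x), ?y) \<in> pi0_rel ?P" using m by (rule_tac pi0_rel_step)
  moreover have "(?z, ?y) \<in> pi0_rel ?P" using pi0_rel_step[OF z m(3)] rack.inv_op[OF rP y m(3)] by simp
  ultimately have "((u,x), ?z) \<in> pi0_rel ?P" using e0 unfolding equiv_def sym_def trans_def by blast
  moreover have zz: "?z = (u, (x \<triangleleft>\<^bsub>src f\<^esub> a) \<triangleleft>\<inverse>\<^bsub>src f\<^esub> b)"
    using u c by (simp add: fibre_product_def rack.op_inv[OF P])
  moreover have "arr (pullback_along p f) (u,x) = arr (pullback_along p f) ?z"
    using m z zz by (simp add: pullback_along_def Let_def)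
  ultimately have "(u,x) = ?z" using t trivial_extension_iff[OF ex] sr by metis
  then show "(x \<triangleleft>\<^bsub>src f\<^esub> a) \<triangleleft>\<inverse>\<^bsub>src f\<^esub> b = x" using zz by simp
qed


lemma words_simps [simp]:
  "[] \<in> words X"
  "(x, e) # w \<in> words X \<longleftrightarrow> x \<in> carrier X \<and> w \<in> words X"
  "u @ v \<in> words X \<longleftrightarrow> u \<in> words X \<and> v \<in> words X"
  by (auto simp: words_def)

lemma path_equiv_words:
  "(u, v) \<in> path_equiv X \<Longrightarrow> u \<in> words X \<and> v \<in> words X"
  unfolding path_equiv_def
  by (induction rule: word_equiv.induct) (auto simp: words_def)

lemma path_equiv_equiv: "rack X \<Longrightarrow> equiv (words X) (path_equiv X)"
  unfolding equiv_def
proof (intro conjI)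
  assume X: "rack X"
  show "path_equiv X \<subseteq> words X \<times> words X" using path_equiv_words by auto
  show "refl_on (words X) (path_equiv X)"
    by (rule refl_onI) (auto simp: path_equiv_def words_def intro: word_equiv.refl)
  show "sym (path_equiv X)" by (rule symI) (auto simp: path_equiv_def intro: word_equiv.sym)
  show "trans (path_equiv X)" by (rule transI) (auto simp: path_equiv_def intro: word_equiv.trans)
qed

lemma path_equiv_append:
  "(u, u') \<in> path_equiv X \<Longrightarrow> (v, v') \<in> path_equiv X \<Longrightarrow> (u @ v, u' @ v') \<in> path_equiv X"
  unfolding path_equiv_def by (rule word_equiv.append)

lemma Pth_mult:
  assumes X: "rack X" and u: "u \<in> words X" and v: "v \<in> words X"
  shows "path_equiv X `` {u} \<otimes>\<^bsub>Pth X\<^esub> path_equiv X `` {v} = path_equiv X `` {u @ v}"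
proof -
  have e: "equiv (words X) (path_equiv X)" by (rule path_equiv_equiv[OF X])
  have "congruent2 (path_equiv X) (path_equiv X) (\<lambda>u v. path_equiv X `` {u @ v})"
    by (auto intro!: congruent2I equiv_class_eq[OF e] path_equiv_append simp: congruent2_def)
  from UN_equiv_class2[OF e e this u v] show ?thesis by (simp add: Pth_def)
qed

lemma Pth_carrier: "carrier (Pth X) = (\<lambda>w. path_equiv X `` {w}) ` words X"
  by (auto simp: Pth_def quotient_def)

definition word_inv :: "('a \<times> bool) list \<Rightarrow> ('a \<times> bool) list" where
  "word_inv w = rev (map (\<lambda>(s, e). (s, \<not> e)) w)"

lemma word_inv_words: "w \<in> words X \<Longrightarrow> word_inv w \<in> words X"
  by (auto simp: word_inv_def words_def)

lemma word_inv_cancel: "rack X \<Longrightarrow> w \<in> words X \<Longrightarrow> (word_inv w @ w, []) \<in> path_equiv X"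
proof (induction w)
  case Nil
  then show ?case by (auto simp: word_inv_def path_equiv_def intro: word_equiv.refl)
next
  case (Cons a w)
  obtain s e where a: "a = (s, e)" by force
  have s: "s \<in> carrier X" and w: "w \<in> words X" using Cons.prems a by simp_all
  note eq = path_equiv_equiv[OF Cons.prems(1)]
  have r: "(u, u) \<in> path_equiv X" if "u \<in> words X" for u
    using eq that by (auto simp: equiv_def refl_on_def)
  have "([(s, \<not> e), (s, e)], []) \<in> path_equiv X"
    using word_equiv.cancel[OF s, of "\<not> e"] by (simp add: path_equiv_def)
  then have "(word_inv w @ ([(s, \<not> e), (s, e)] @ w), word_inv w @ ([] @ w)) \<in> path_equiv X"
    by (intro path_equiv_append r word_inv_words w)
  moreover have "(word_inv w @ w, []) \<in> path_equiv X" using Cons w by auto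
  ultimately have "(word_inv w @ ([(s, \<not> e), (s, e)] @ w), []) \<in> path_equiv X"
    using eq unfolding equiv_def by (auto dest: transD)
  then show ?case by (simp add: word_inv_def a)
qed

lemma group_Pth: assumes X: "rack X" shows "group (Pth X)"
proof (rule groupI)
  note e = path_equiv_equiv[OF X]
  have one: "\<one>\<^bsub>Pth X\<^esub> = path_equiv X `` {[]}" by (simp add: Pth_def)
  show "\<one>\<^bsub>Pth X\<^esub> \<in> carrier (Pth X)" by (auto simp: one Pth_carrier)
  fix x assume x: "x \<in> carrier (Pth X)"
  then obtain u where u: "u \<in> words X" "x = path_equiv X `` {u}" by (auto simp: Pth_carrier)
  show "\<one>\<^bsub>Pth X\<^esub> \<otimes>\<^bsub>Pth X\<^esub> x = x" using u by (simp add: one Pth_mult[OF X])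
  show "\<exists>y\<in>carrier (Pth X). y \<otimes>\<^bsub>Pth X\<^esub> x = \<one>\<^bsub>Pth X\<^esub>"
  proof (rule bexI[of _ "path_equiv X `` {word_inv u}"])
    show "path_equiv X `` {word_inv u} \<otimes>\<^bsub>Pth X\<^esub> x = \<one>\<^bsub>Pth X\<^esub>"
      using u equiv_class_eq[OF e word_inv_cancel[OF X u(1)]] by (simp add: one Pth_mult[OF X] word_inv_words)
    show "path_equiv X `` {word_inv u} \<in> carrier (Pth X)"
      using word_inv_words[OF u(1)] by (auto simp: Pth_carrier)
  qed
  fix y assume y: "y \<in> carrier (Pth X)"
  then obtain v where v: "v \<in> words X" "y = path_equiv X `` {v}" by (auto simp: Pth_carrier)
  show "x \<otimes>\<^bsub>Pth X\<^esub> y \<in> carrier (Pth X)" using u v by (auto simp: Pth_mult[OF X] Pth_carrier)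
  fix z assume z: "z \<in> carrier (Pth X)"
  then obtain w where w: "w \<in> words X" "z = path_equiv X `` {w}" by (auto simp: Pth_carrier)
  show "x \<otimes>\<^bsub>Pth X\<^esub> y \<otimes>\<^bsub>Pth X\<^esub> z = x \<otimes>\<^bsub>Pth X\<^esub> (y \<otimes>\<^bsub>Pth X\<^esub> z)"
    using u v w by (simp add: Pth_mult[OF X])
qed

lemma path_gen_closed: "x \<in> carrier X \<Longrightarrow> path_gen X x \<in> carrier (Pth X)"
  by (auto simp: path_gen_def Pth_carrier)

lemma word_act_append: "word_act X x (u @ v) = word_act X (word_act X x u) v"
  by (simp add: word_act_def)

lemma word_act_closed: "rack X \<Longrightarrow> w \<in> words X \<Longrightarrow> x \<in> carrier X \<Longrightarrow> word_act X x w \<in> carrier X"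
proof (induction w arbitrary: x)
  case (Cons a w)
  obtain s e where "a = (s, e)" by force
  with Cons show ?case
    by (auto simp: word_act_def rack.op_closed rack.inv_closed)
qed (simp add: word_act_def)

locale lifted_action =
  fixes B :: "'b rack" and X :: "'a rack" and L :: "'b \<Rightarrow> 'a"
  assumes B: "rack B" and X: "rack X"
    and L: "b \<in> carrier B \<Longrightarrow> L b \<in> carrier X"
    and L_op: "x \<in> carrier X \<Longrightarrow> b \<in> carrier B \<Longrightarrow> c \<in> carrier B \<Longrightarrow>
      x \<triangleleft>\<^bsub>X\<^esub> L (b \<triangleleft>\<^bsub>B\<^esub> c) = x \<triangleleft>\<^bsub>X\<^esub> (L b \<triangleleft>\<^bsub>X\<^esub> L c)"
begin

definition lift :: "('b \<times> bool) list \<Rightarrow> ('a \<times> bool) list" where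
  "lift w = map (\<lambda>(b, e). (L b, e)) w"

lemma lift_words: "w \<in> words B \<Longrightarrow> lift w \<in> words X"
  by (induction w) (auto simp: lift_def L)

lemma lift_append: "lift (u @ v) = lift u @ lift v"
  by (simp add: lift_def)

lemma lift_equiv:
  "(u, v) \<in> path_equiv B \<Longrightarrow> x \<in> carrier X \<Longrightarrow> word_act X x (lift u) = word_act X x (lift v)"
  unfolding path_equiv_def
proof (induction arbitrary: x rule: word_equiv.induct)
  case (append u u' v v')
  have "u' \<in> words B" using append.hyps(1) path_equiv_words unfolding path_equiv_def by blast
  then have "word_act X x (lift u') \<in> carrier X" by (intro word_act_closed X lift_words append.prems)
  then show ?case using append by (simp add: lift_append word_act_append)
next
  case (cancel s e)
  then show ?case
    by (cases e) (auto simp: lift_def word_act_def rack.op_inv[OF X] rack.inv_op[OF X] L)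
next
  case (relation u v)
  then obtain b c where bc: "u = [(b \<triangleleft>\<^bsub>B\<^esub> c, True)]" "v = [(c, False), (b, True), (c, True)]"
     "b \<in> carrier B" "c \<in> carrier B" by auto
  have "x \<triangleleft>\<^bsub>X\<^esub> L (b \<triangleleft>\<^bsub>B\<^esub> c) = ((x \<triangleleft>\<inverse>\<^bsub>X\<^esub> L c) \<triangleleft>\<^bsub>X\<^esub> L b) \<triangleleft>\<^bsub>X\<^esub> L c"
    using L_op[OF relation.prems bc(3,4)] rack.self_distrib[OF X, of "x \<triangleleft>\<inverse>\<^bsub>X\<^esub> L c" "L b" "L c"]
      rack.inv_op[OF X] rack.inv_closed[OF X] L bc relation.prems by simp
  then show ?case by (simp add: bc lift_def word_act_def)
qed auto

definition act :: "'a \<Rightarrow> ('b \<times> bool) list set \<Rightarrow> 'a" where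
  "act x g = word_act X x (lift (SOME w. w \<in> g))"

lemma act_class:
  assumes w: "w \<in> words B" and x: "x \<in> carrier X"
  shows "act x (path_equiv B `` {w}) = word_act X x (lift w)"
proof -
  have "w \<in> path_equiv B `` {w}" using equiv_class_self[OF path_equiv_equiv[OF B] w] .
  then have "(w, SOME v. v \<in> path_equiv B `` {w}) \<in> path_equiv B"
    by (metis Image_singleton_iff someI_ex)
  then show ?thesis using lift_equiv x by (auto simp: act_def)
qed

lemma act_closed: "g \<in> carrier (Pth B) \<Longrightarrow> x \<in> carrier X \<Longrightarrow> act x g \<in> carrier X"
  by (auto simp: Pth_carrier act_class intro!: word_act_closed X lift_words)

lemma act_one: "x \<in> carrier X \<Longrightarrow> act x \<one>\<^bsub>Pth B\<^esub> = x"
  using act_class[of "[]" x] by (simp add: Pth_def lift_def word_act_def)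

lemma act_mult:
  "g \<in> carrier (Pth B) \<Longrightarrow> h \<in> carrier (Pth B) \<Longrightarrow> x \<in> carrier X \<Longrightarrow>
   act x (g \<otimes>\<^bsub>Pth B\<^esub> h) = act (act x g) h"
  by (auto simp: Pth_carrier Pth_mult[OF B] act_class lift_append word_act_append word_act_closed[OF X] lift_words)

lemma act_gen: "b \<in> carrier B \<Longrightarrow> x \<in> carrier X \<Longrightarrow> act x (path_gen B b) = x \<triangleleft>\<^bsub>X\<^esub> L b"
  using act_class[of "[(b, True)]" x] by (simp add: path_gen_def lift_def word_act_def)

lemma act_inv_left: "g \<in> carrier (Pth B) \<Longrightarrow> x \<in> carrier X \<Longrightarrow> act (act x (inv\<^bsub>Pth B\<^esub> g)) g = x"
  using act_mult[of "inv\<^bsub>Pth B\<^esub> g" g x] group.inv_closed[OF group_Pth[OF B]]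
    group.l_inv[OF group_Pth[OF B]] act_one by simp

lemma act_inv_right: "g \<in> carrier (Pth B) \<Longrightarrow> x \<in> carrier X \<Longrightarrow> act (act x g) (inv\<^bsub>Pth B\<^esub> g) = x"
  using act_mult[of g "inv\<^bsub>Pth B\<^esub> g" x] group.inv_closed[OF group_Pth[OF B]]
    group.r_inv[OF group_Pth[OF B]] act_one by simp

lemma act_inv_gen:
  "b \<in> carrier B \<Longrightarrow> x \<in> carrier X \<Longrightarrow> act x (inv\<^bsub>Pth B\<^esub> path_gen B b) = x \<triangleleft>\<inverse>\<^bsub>X\<^esub> L b"
  using act_inv_right[of "path_gen B b" "x \<triangleleft>\<inverse>\<^bsub>X\<^esub> L b"] act_gen[of b "x \<triangleleft>\<inverse>\<^bsub>X\<^esub> L b"]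
  by (simp add: path_gen_closed rack.inv_op[OF X] rack.inv_closed[OF X] L)

lemma inv_distrib:
  assumes "x \<in> carrier X" "y \<in> carrier X" "z \<in> carrier X"
  shows "(x \<triangleleft>\<^bsub>X\<^esub> y) \<triangleleft>\<inverse>\<^bsub>X\<^esub> z = (x \<triangleleft>\<inverse>\<^bsub>X\<^esub> z) \<triangleleft>\<^bsub>X\<^esub> (y \<triangleleft>\<inverse>\<^bsub>X\<^esub> z)"
proof -
  let ?x = "x \<triangleleft>\<inverse>\<^bsub>X\<^esub> z" and ?y = "y \<triangleleft>\<inverse>\<^bsub>X\<^esub> z"
  have c: "?x \<in> carrier X" "?y \<in> carrier X" using assms rack.inv_closed[OF X] by auto
  have "(?x \<triangleleft>\<^bsub>X\<^esub> ?y) \<triangleleft>\<^bsub>X\<^esub> z = x \<triangleleft>\<^bsub>X\<^esub> y"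
    using rack.self_distrib[OF X c assms(3)] rack.inv_op[OF X] assms by simp
  then show ?thesis using rack.op_inv[OF X rack.op_closed[OF X c] assms(3)] by simp
qed

lemma word_act_op:
  "w \<in> words X \<Longrightarrow> x \<in> carrier X \<Longrightarrow> y \<in> carrier X \<Longrightarrow>
   word_act X (x \<triangleleft>\<^bsub>X\<^esub> y) w = word_act X x w \<triangleleft>\<^bsub>X\<^esub> word_act X y w"
proof (induction w arbitrary: x y)
  case (Cons a w)
  obtain s e where a: "a = (s, e)" by force
  have s: "s \<in> carrier X" and w: "w \<in> words X" using Cons.prems(1) by (simp_all add: a)
  have step: "word_act X x (a # w) =
      word_act X (if e then x \<triangleleft>\<^bsub>X\<^esub> s else x \<triangleleft>\<inverse>\<^bsub>X\<^esub> s) w" for x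
    by (simp add: word_act_def a)
  show ?case
    using Cons.IH[OF w] rack.self_distrib[OF X Cons.prems(2,3) s] inv_distrib[OF Cons.prems(2,3) s]
      rack.op_closed[OF X _ s] rack.inv_closed[OF X _ s] Cons.prems(2,3)
    by (simp only: step split: if_split) simp
qed (simp add: word_act_def)

lemma act_op:
  "g \<in> carrier (Pth B) \<Longrightarrow> x \<in> carrier X \<Longrightarrow> y \<in> carrier X \<Longrightarrow>
   act (x \<triangleleft>\<^bsub>X\<^esub> y) g = act x g \<triangleleft>\<^bsub>X\<^esub> act y g"
  by (auto simp: Pth_carrier act_class rack.op_closed[OF X] intro!: word_act_op lift_words)

lemma act_op_inv:
  assumes "g \<in> carrier (Pth B)" "x \<in> carrier X" "y \<in> carrier X"
  shows "act (x \<triangleleft>\<inverse>\<^bsub>X\<^esub> y) g = act x g \<triangleleft>\<inverse>\<^bsub>X\<^esub> act y g"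
proof -
  have c: "x \<triangleleft>\<inverse>\<^bsub>X\<^esub> y \<in> carrier X" using assms rack.inv_closed[OF X] by auto
  have "act x g = act (x \<triangleleft>\<inverse>\<^bsub>X\<^esub> y) g \<triangleleft>\<^bsub>X\<^esub> act y g"
    using act_op[OF assms(1) c assms(3)] assms by (simp add: rack.inv_op[OF X])
  then show ?thesis using rack.op_inv[OF X] act_closed c assms by simp
qed

lemma act_conj:
  assumes "g \<in> carrier (Pth B)" "x \<in> carrier X" "b \<in> carrier B"
  shows "act (act (act x (inv\<^bsub>Pth B\<^esub> g)) (path_gen B b)) g = x \<triangleleft>\<^bsub>X\<^esub> act (L b) g"
    and "act (act (act x (inv\<^bsub>Pth B\<^esub> g)) (inv\<^bsub>Pth B\<^esub> path_gen B b)) g = x \<triangleleft>\<inverse>\<^bsub>X\<^esub> act (L b) g"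
proof -
  have c: "act x (inv\<^bsub>Pth B\<^esub> g) \<in> carrier X"
    using assms group.inv_closed[OF group_Pth[OF B]] act_closed by auto
  show "act (act (act x (inv\<^bsub>Pth B\<^esub> g)) (path_gen B b)) g = x \<triangleleft>\<^bsub>X\<^esub> act (L b) g"
    using c assms by (simp add: act_gen act_op L act_inv_left)
  show "act (act (act x (inv\<^bsub>Pth B\<^esub> g)) (inv\<^bsub>Pth B\<^esub> path_gen B b)) g = x \<triangleleft>\<inverse>\<^bsub>X\<^esub> act (L b) g"
    using c assms by (simp add: act_inv_gen act_op_inv L act_inv_left)
qed

end


text \<open>The extension \<open>(b, g) \<mapsto> b \<cdot> g\<close> with domain \<open>B \<times> Pth(B)\<close>.\<close>

definition path_rack :: "'b rack \<Rightarrow> ('b \<times> ('b \<times> bool) list set) rack" where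
  "path_rack B =
     \<lparr>carrier = carrier B \<times> carrier (Pth B),
      rop = (\<lambda>(s, g) (t, h).
        (s, g \<otimes>\<^bsub>Pth B\<^esub> (inv\<^bsub>Pth B\<^esub> h \<otimes>\<^bsub>Pth B\<^esub> (path_gen B t \<otimes>\<^bsub>Pth B\<^esub> h)))),
      rop_inv = (\<lambda>(s, g) (t, h).
        (s, g \<otimes>\<^bsub>Pth B\<^esub> (inv\<^bsub>Pth B\<^esub> h \<otimes>\<^bsub>Pth B\<^esub> (inv\<^bsub>Pth B\<^esub> path_gen B t \<otimes>\<^bsub>Pth B\<^esub> h))))\<rparr>"

lemma (in group) cancel_left:
  "x \<in> carrier G \<Longrightarrow> y \<in> carrier G \<Longrightarrow> x \<otimes> (inv x \<otimes> y) = y"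
  "x \<in> carrier G \<Longrightarrow> y \<in> carrier G \<Longrightarrow> inv x \<otimes> (x \<otimes> y) = y"
  by (simp_all add: m_assoc[symmetric])

lemma rack_path_rack: assumes B: "rack B" shows "rack (path_rack B)"
proof -
  interpret group "Pth B" by (rule group_Pth[OF B])
  show ?thesis
    by unfold_locales
      (auto simp: path_rack_def path_gen_closed m_assoc inv_mult_group cancel_left)
qed

lemma covering_central:
  assumes c: "covering f"
  shows "central f"
proof -
  let ?A = "src f" and ?B = "tgt f" and ?G = "Pth (tgt f)" and ?E = "path_rack (tgt f)"
  have f: "extension f" using c by (simp add: covering_def)
  have h: "arr f \<in> rack_hom ?A ?B" and A: "rack ?A" and B: "rack ?B"
    and s: "arr f ` carrier ?A = carrier ?B"
    using f by (auto simp: extension_def)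
  have cov: "x \<triangleleft>\<^bsub>?A\<^esub> a = x \<triangleleft>\<^bsub>?A\<^esub> b"
    if "x \<in> carrier ?A" "a \<in> carrier ?A" "b \<in> carrier ?A" "arr f a = arr f b" for x a b
  proof -
    have "(a, b) \<in> Eq f" using that by (simp add: Eq_def)
    then have "(x \<triangleleft>\<^bsub>?A\<^esub> a) \<triangleleft>\<inverse>\<^bsub>?A\<^esub> b = x" using c that(1) unfolding covering_def by blast
    then show ?thesis using rack.inv_op[OF A rack.op_closed[OF A that(1,2)] that(3)] by simp
  qed
  define L where "L b = (SOME a. a \<in> carrier ?A \<and> arr f a = b)" for b
  have L: "L b \<in> carrier ?A \<and> arr f (L b) = b" if "b \<in> carrier ?B" for b
  proof -
    have "\<exists>a. a \<in> carrier ?A \<and> arr f a = b" using that s by (metis imageE)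
    then show ?thesis unfolding L_def by (rule someI_ex)
  qed
  interpret U: lifted_action ?B ?A L
  proof (rule lifted_action.intro)
    fix x b c assume "x \<in> carrier ?A" "b \<in> carrier ?B" "c \<in> carrier ?B"
    then show "x \<triangleleft>\<^bsub>?A\<^esub> L (b \<triangleleft>\<^bsub>?B\<^esub> c) = x \<triangleleft>\<^bsub>?A\<^esub> (L b \<triangleleft>\<^bsub>?A\<^esub> L c)"
      using L rack.op_closed[OF A] rack.op_closed[OF B] rack_hom_op[OF h] by (intro cov) simp_all
  qed (use A B L in auto)
  interpret V: lifted_action ?B ?B "\<lambda>b. b"
    by (rule lifted_action.intro) (use B in auto)
  interpret G: group ?G by (rule group_Pth[OF B])
  have equivariant: "arr f (U.act a g) = V.act (arr f a) g"
    if a: "a \<in> carrier ?A" and g: "g \<in> carrier ?G" for a g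
  proof -
    have "w \<in> words ?B \<Longrightarrow> a \<in> carrier ?A \<Longrightarrow>
        arr f (word_act ?A a (U.lift w)) = word_act ?B (arr f a) (V.lift w)" for w
    proof (induction w arbitrary: a)
      case (Cons l w)
      obtain b e where l: "l = (b, e)" by force
      have "b \<in> carrier ?B" "w \<in> words ?B" using Cons.prems(1) by (simp_all add: l)
      then show ?case
        using Cons.IH Cons.prems(2) L rack_hom_op[OF h] rack_hom_inv[OF h] rack.op_closed[OF A] rack.inv_closed[OF A]
        by (simp add: l U.lift_def V.lift_def word_act_def)
    qed (simp add: U.lift_def V.lift_def word_act_def)
    then show ?thesis
      using g a rack_hom_closed[OF h a] by (auto simp: Pth_carrier U.act_class V.act_class)
  qed
  define p where "p = \<lparr>src = ?E, tgt = ?B, arr = (\<lambda>(s, g) \<in> carrier ?E. V.act s g)\<rparr>"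
  have E: "rack ?E" by (rule rack_path_rack[OF B])
  have cE: "carrier ?E = carrier ?B \<times> carrier ?G" by (simp add: path_rack_def)
  have p_app: "arr p (s, g) = V.act s g" if "s \<in> carrier ?B" "g \<in> carrier ?G" for s g
    using that by (simp add: p_def cE)
  have hp: "arr p \<in> rack_hom ?E ?B"
    unfolding rack_hom_def mem_Collect_eq
  proof (intro conjI ballI)
    show "arr p \<in> carrier ?E \<rightarrow>\<^sub>E carrier ?B"
      by (auto simp: p_def cE intro: V.act_closed)
    fix x y assume "x \<in> carrier ?E" "y \<in> carrier ?E"
    then obtain s g t k where xy: "x = (s, g)" "y = (t, k)" and m: "s \<in> carrier ?B" "t \<in> carrier ?B"
      "g \<in> carrier ?G" "k \<in> carrier ?G" by (auto simp: cE)
    have cl: "V.act s g \<in> carrier ?B" using m V.act_closed by auto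
    have e1: "x \<triangleleft>\<^bsub>?E\<^esub> y = (s, g \<otimes>\<^bsub>?G\<^esub> (inv\<^bsub>?G\<^esub> k \<otimes>\<^bsub>?G\<^esub> (path_gen ?B t \<otimes>\<^bsub>?G\<^esub> k)))"
      and e2: "x \<triangleleft>\<inverse>\<^bsub>?E\<^esub> y = (s, g \<otimes>\<^bsub>?G\<^esub> (inv\<^bsub>?G\<^esub> k \<otimes>\<^bsub>?G\<^esub> (inv\<^bsub>?G\<^esub> path_gen ?B t \<otimes>\<^bsub>?G\<^esub> k)))"
      by (simp_all add: xy path_rack_def)
    show "arr p (x \<triangleleft>\<^bsub>?E\<^esub> y) = arr p x \<triangleleft>\<^bsub>?B\<^esub> arr p y"
      unfolding e1 using m cl V.act_conj(1)[OF m(4) cl m(2)]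
      by (simp add: xy p_app V.act_mult path_gen_closed V.act_closed)
    show "arr p (x \<triangleleft>\<inverse>\<^bsub>?E\<^esub> y) = arr p x \<triangleleft>\<inverse>\<^bsub>?B\<^esub> arr p y"
      unfolding e2 using m cl V.act_conj(2)[OF m(4) cl m(2)]
      by (simp add: xy p_app V.act_mult path_gen_closed V.act_closed)
  qed
  have "arr p ` carrier ?E = carrier ?B"
  proof (intro equalityI subsetI)
    fix b assume b: "b \<in> carrier ?B"
    then have "b = arr p (b, \<one>\<^bsub>?G\<^esub>)" by (simp add: p_app V.act_one)
    then show "b \<in> arr p ` carrier ?E" using b by (auto simp: cE)
  qed (use rack_hom_closed[OF hp] in auto)
  then have p: "extension p" using E B hp by (auto simp: extension_def p_def)
  let ?P = "fibre_product ?E ?A (arr p) (arr f)"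
  let ?t = "pullback_along p f"
  have t: "extension ?t" by (rule pullback_along_extension[OF p f]) (simp add: p_def)
  have srct: "src ?t = ?P" by (simp add: pullback_along_def Let_def p_def)
  have P: "rack ?P" using t srct by (simp add: extension_def)
  define I where "I = (\<lambda>((s :: 'b, g), a). U.act a (inv\<^bsub>?G\<^esub> g))"
  let ?R = "{(z, z'). z \<in> carrier ?P \<and> z' \<in> carrier ?P \<and> I z = I z'}"
  have "equiv (carrier ?P) ?R"
    by (rule equivI) (auto simp: refl_on_def sym_def trans_def)
  moreover have "{(x, x \<triangleleft>\<^bsub>?P\<^esub> y) | x y. x \<in> carrier ?P \<and> y \<in> carrier ?P} \<subseteq> ?R"
  proof (rule subsetI)
    fix z assume "z \<in> {(x, x \<triangleleft>\<^bsub>?P\<^esub> y) | x y. x \<in> carrier ?P \<and> y \<in> carrier ?P}"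
    then obtain x y where z: "z = (x, x \<triangleleft>\<^bsub>?P\<^esub> y)" and x: "x \<in> carrier ?P" and y: "y \<in> carrier ?P" by blast
    obtain s g a t k d where xy: "x = ((s, g), a)" "y = ((t, k), d)" by (metis prod.exhaust)
    have m: "s \<in> carrier ?B" "t \<in> carrier ?B" "g \<in> carrier ?G" "k \<in> carrier ?G"
      "a \<in> carrier ?A" "d \<in> carrier ?A" and d: "V.act t k = arr f d"
      using x y by (auto simp: fibre_product_def xy cE p_app)
    let ?c = "inv\<^bsub>?G\<^esub> k \<otimes>\<^bsub>?G\<^esub> (path_gen ?B t \<otimes>\<^bsub>?G\<^esub> k)"
    have cc: "?c \<in> carrier ?G" using m by (simp add: path_gen_closed)
    have "U.act a ?c = a \<triangleleft>\<^bsub>?A\<^esub> U.act (L t) k"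
      using U.act_conj(1)[OF m(4,5,2)] m by (simp add: U.act_mult path_gen_closed U.act_closed)
    also have "\<dots> = a \<triangleleft>\<^bsub>?A\<^esub> d"
      using m L d equivariant by (intro cov) (auto intro: U.act_closed)
    finally have ac: "U.act a ?c = a \<triangleleft>\<^bsub>?A\<^esub> d" .
    have "x \<triangleleft>\<^bsub>?P\<^esub> y = ((s, g \<otimes>\<^bsub>?G\<^esub> ?c), a \<triangleleft>\<^bsub>?A\<^esub> d)"
      by (simp add: xy fibre_product_def path_rack_def)
    then have "I (x \<triangleleft>\<^bsub>?P\<^esub> y) = U.act (U.act a ?c) (inv\<^bsub>?G\<^esub> (g \<otimes>\<^bsub>?G\<^esub> ?c))"
      by (simp add: I_def ac)
    also have "\<dots> = U.act (U.act (U.act a ?c) (inv\<^bsub>?G\<^esub> ?c)) (inv\<^bsub>?G\<^esub> g)"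
      using m cc U.act_closed[OF cc m(5)]
      by (simp only: G.inv_mult_group U.act_mult G.inv_closed)
    also have "\<dots> = I x" by (simp only: U.act_inv_right[OF cc m(5)]) (simp add: I_def xy)
    finally show "z \<in> ?R" unfolding z using x y rack.op_closed[OF P x y] by simp
  qed
  ultimately have sub: "pi0_rel ?P \<subseteq> ?R" unfolding pi0_rel_def by (rule generated_equiv_least)
  have "trivial_extension ?t"
    unfolding trivial_extension_iff[OF t]
  proof (intro allI impI)
    fix x x' assume a: "(x, x') \<in> pi0_rel (src ?t) \<and> arr ?t x = arr ?t x'"
    then have x: "x \<in> carrier ?P" "x' \<in> carrier ?P" "I x = I x'" using sub srct by auto
    then have "fst x = fst x'" using a by (simp add: pullback_along_def Let_def p_def)
    then obtain s g a a' where e: "x = ((s, g), a)" "x' = ((s, g), a')" by (metis prod.exhaust fst_conv)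
    have m: "g \<in> carrier ?G" "a \<in> carrier ?A" "a' \<in> carrier ?A"
      using x by (auto simp: e fibre_product_def cE)
    have "U.act (U.act a (inv\<^bsub>?G\<^esub> g)) g = U.act (U.act a' (inv\<^bsub>?G\<^esub> g)) g"
      using x(3) by (simp add: I_def e)
    then have "a = a'" using U.act_inv_left m by simp
    then show "x = x'" by (simp add: e)
  qed
  then show ?thesis using f p unfolding central_def by (intro conjI exI[of _ p]) (auto simp: p_def)
qed

lemma central_iff_covering: "central f \<longleftrightarrow> covering f"
  using covering_central covering_if_trivial_pullback unfolding central_def by blast

lemma central_if_trivial_pullback:
  fixes p :: "('e, 'b) rack_arrow" and f :: "('a, 'b) rack_arrow"
  assumes "extension p" and "extension f" and "tgt p = tgt f"
    and "trivial_extension (pullback_along p f)"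
  shows "central f"
  by (rule covering_central[OF covering_if_trivial_pullback[OF assms]])

end

theory Submission
  imports Defs
begin

text \<open>
  Let \<open>f: A \<rightarrow> B\<close> be an extension. Everything rests on one notion: two words in the generators of
  \<open>Pth(A)\<close> are symmetric if \<open>f\<close>, applied letter by letter, sends them to the same word. The
  endpoints of \<open>f\<close>-horns are the pairs \<open>(x \<cdot> u, x \<cdot> v)\<close> with \<open>u\<close>, \<open>v\<close> symmetric, and the
  \<open>f\<close>-symmetric paths turn out to be the quotients \<open>u v\<inverse>\<close> of such words.

  Kernel. The quotients \<open>u v\<inverse>\<close> form a normal subgroup \<open>N\<close> of \<open>Pth(A)\<close>. Modulo \<open>N\<close>, all lifts to
  \<open>A\<close> of one word over \<open>B\<close> agree, and each relation of the presentation of \<open>Pth(B)\<close> lifts, because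
  \<open>f\<close> is surjective and preserves the operation. Hence words over \<open>A\<close> whose images are equal in
  \<open>Pth(B)\<close> agree modulo \<open>N\<close> (\<open>lifts_of_equivalent_words\<close>), so the kernel of \<open>Pth(f)\<close> lies in
  \<open>N\<close>. Clearly \<open>N\<close> consists of symmetric paths, and these lie in the kernel.

  Congruence. Endpoints of horns form an equivalence relation which contains the pairs that
  generate \<open>C1 f\<close>. Conversely \<open>Pth(A)\<close> acts by automorphisms of \<open>A\<close> that respect \<open>Eq(f)\<close>, so
  \<open>C1 f\<close> is stable under the action; this allows the letters of \<open>u\<close> to be exchanged for those
  of \<open>v\<close> one at a time, without leaving the \<open>C1 f\<close>-class of \<open>x \<cdot> u\<close>. Thus \<open>C1 f\<close> is the relation
  of being endpoints of a horn (\<open>C1_eq_horn_endpoints\<close>). Appending symmetric letters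
  to both sides of a horn shows that it is a congruence, and moving the start of a horn to one of
  its endpoints shows that it is the orbit relation of \<open>N\<close>.

  Reflection. Central extensions are coverings, and the generating pairs of \<open>C1 f\<close> are exactly
  what has to be identified to make \<open>f\<close> a covering. A morphism from \<open>f\<close> to a covering therefore
  factors through the quotient by \<open>C1 f\<close>, uniquely since the quotient map is onto
  (\<open>F1_universal\<close>). Functoriality of \<open>F1\<close> and naturality of the unit follow from this universal
  property. The unit is a double extension because its bottom component is an identity and its top
  component is onto.
\<close>

section \<open>Words of generators and their action\<close>

lemma word_inv_involutive [simp]: "word_inv (word_inv w) = w"
  by (simp add: word_inv_def rev_map o_def case_prod_unfold)

lemma word_inv_append [simp]: "word_inv (u @ v) = word_inv v @ word_inv u"
  by (simp add: word_inv_def)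

context rack
begin

sublocale self_action: lifted_action X X "\<lambda>x. x"
  by unfold_locales simp_all

lemma lift_self [simp]: "self_action.lift w = w"
  by (simp add: self_action.lift_def)

text \<open>The relations of \<open>Pth(X)\<close> hold for the translations of \<open>X\<close>, so a path acts as any of its words;
  this is the lifted action for the identity of \<open>X\<close>. From here on the action is computed on words.\<close>

lemma path_act_class:
  assumes w: "w \<in> words X" and x: "x \<in> carrier X"
  shows "path_act X x (path_equiv X `` {w}) = word_act X x w"
proof -
  have "word_act X x v = word_act X x w" if "v \<in> path_equiv X `` {w}" for v
    using self_action.lift_equiv[OF _ x, of w v] that by simp
  moreover have "w \<in> path_equiv X `` {w}"
    by (rule equiv_class_self[OF path_equiv_equiv[OF rack_axioms] w])
  ultimately have "word_act X x ` (path_equiv X `` {w}) = {word_act X x w}"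
    by (intro equalityI subsetI; blast)
  then show ?thesis by (simp add: path_act_def)
qed

lemma word_act_inv:
  assumes w: "w \<in> words X" and x: "x \<in> carrier X"
  shows "word_act X (word_act X x w) (word_inv w) = x"
    and "word_act X (word_act X x (word_inv w)) w = x"
proof -
  have "word_act X (word_act X x (word_inv u)) u = x" if "u \<in> words X" for u
    using self_action.lift_equiv[OF word_inv_cancel[OF rack_axioms that] x]
    by (simp add: word_act_append) (simp add: word_act_def)
  from this[OF w] this[OF word_inv_words[OF w]]
  show "word_act X (word_act X x w) (word_inv w) = x"
    and "word_act X (word_act X x (word_inv w)) w = x" by simp_all
qed

lemma path_one: "\<one>\<^bsub>Pth X\<^esub> = path_equiv X `` {[]}"
  by (simp add: Pth_def)

lemma path_closed: "w \<in> words X \<Longrightarrow> path_equiv X `` {w} \<in> carrier (Pth X)"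
  by (auto simp: Pth_carrier)

lemma path_eq_iff:
  "u \<in> words X \<Longrightarrow> v \<in> words X \<Longrightarrow>
   path_equiv X `` {u} = path_equiv X `` {v} \<longleftrightarrow> (u, v) \<in> path_equiv X"
  using eq_equiv_class_iff[OF path_equiv_equiv[OF rack_axioms]] .

lemma path_inv:
  assumes w: "w \<in> words X"
  shows "inv\<^bsub>Pth X\<^esub> (path_equiv X `` {w}) = path_equiv X `` {word_inv w}"
proof -
  interpret P: group "Pth X" by (rule group_Pth[OF rack_axioms])
  have "path_equiv X `` {word_inv w} \<otimes>\<^bsub>Pth X\<^esub> path_equiv X `` {w} = \<one>\<^bsub>Pth X\<^esub>"
    using w word_inv_words[OF w] word_inv_cancel[OF rack_axioms w]
    by (simp add: Pth_mult[OF rack_axioms] path_one path_eq_iff)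
  then show ?thesis
    using w by (intro P.inv_equality) (simp_all add: path_closed word_inv_words)
qed

text \<open>Products of signed generators are classes of words, the sign \<open>1\<close> becoming the positive letter.
  Only \<open>1\<close> and \<open>- 1\<close> can occur as exponents, hence the translation \<open>d = 1\<close>.\<close>

lemma path_prod_word:
  assumes "\<forall>(a, d) \<in> set L. a \<in> carrier X \<and> d \<in> {- 1, 1}"
  shows "map (\<lambda>(a, d). (a, d = 1)) L \<in> words X \<and>
    path_prod X L = path_equiv X `` {map (\<lambda>(a, d). (a, d = 1)) L}"
  using assms
proof (induction L)
  case Nil
  then show ?case by (simp add: path_prod_def path_one)
next
  case (Cons l L)
  obtain a d where l: "l = (a, d)" by force
  interpret P: group "Pth X" by (rule group_Pth[OF rack_axioms])
  have a: "a \<in> carrier X" and d: "d = 1 \<or> d = - 1" using Cons.prems by (auto simp: l)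
  have "path_gen X a [^]\<^bsub>Pth X\<^esub> d = path_equiv X `` {[(a, d = 1)]}"
  proof (cases "d = 1")
    case True
    then show ?thesis using path_gen_closed[OF a] by (simp add: path_gen_def)
  next
    case False
    then have "d = - 1" using d by simp
    then have "path_gen X a [^]\<^bsub>Pth X\<^esub> d = inv\<^bsub>Pth X\<^esub> (path_gen X a)"
      using path_gen_closed[OF a] by (simp add: P.int_pow_neg)
    then show ?thesis using a \<open>d = - 1\<close> by (simp add: path_gen_def path_inv word_inv_def)
  qed
  moreover have "path_prod X (l # L) = (path_gen X a [^]\<^bsub>Pth X\<^esub> d) \<otimes>\<^bsub>Pth X\<^esub> path_prod X L"
    by (simp add: path_prod_def l)
  ultimately show ?case
    using Cons a by (auto simp: l Pth_mult[OF rack_axioms])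
qed

end

definition word_map :: "('a, 'b) rack_arrow \<Rightarrow> ('a \<times> bool) list \<Rightarrow> ('b \<times> bool) list" where
  "word_map f w = map (map_prod (arr f) id) w"

lemma word_map_simps [simp]:
  "word_map f [] = []"
  "word_map f ((a, e) # w) = (arr f a, e) # word_map f w"
  "word_map f (u @ v) = word_map f u @ word_map f v"
  by (simp_all add: word_map_def)

lemma word_map_eq_Nil [simp]: "word_map f u = [] \<longleftrightarrow> u = []" "[] = word_map f u \<longleftrightarrow> u = []"
  by (auto simp: word_map_def)

lemma word_map_eq_Cons:
  "word_map f u = (b, e) # w \<longleftrightarrow> (\<exists>a u'. u = (a, e) # u' \<and> arr f a = b \<and> word_map f u' = w)"
  by (cases u) (auto simp: word_map_def)

lemma word_map_eq_append:
  "word_map f u = s @ t \<longleftrightarrow> (\<exists>u1 u2. u = u1 @ u2 \<and> word_map f u1 = s \<and> word_map f u2 = t)"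
  by (auto simp: word_map_def map_eq_append_conv)

lemma word_map_inv: "word_map f (word_inv w) = word_inv (word_map f w)"
  by (simp add: word_map_def word_inv_def rev_map case_prod_unfold)

section \<open>Symmetric words and horns\<close>

definition symmetric_words :: "('a, 'b) rack_arrow \<Rightarrow> (('a \<times> bool) list \<times> ('a \<times> bool) list) set" where
  "symmetric_words f =
     {(u, v). u \<in> words (src f) \<and> v \<in> words (src f) \<and> word_map f u = word_map f v}"

definition left_word :: "('a \<times> 'a \<times> int) list \<Rightarrow> ('a \<times> bool) list" where
  "left_word M = map (\<lambda>(a, b, d). (a, d = 1)) M"

definition right_word :: "('a \<times> 'a \<times> int) list \<Rightarrow> ('a \<times> bool) list" where
  "right_word M = map (\<lambda>(a, b, d). (b, d = 1)) M"

text \<open>Horns and symmetric words carry the same data: a list of triples \<open>(a, b, \<delta>)\<close> is a pair of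
  words of equal length, letterwise related by \<open>Eq f\<close> and with the same signs.\<close>

lemma symmetric_words_horn:
  assumes "(u, v) \<in> symmetric_words f"
  shows "\<exists>M. (\<forall>(a, b, d) \<in> set M. (a, b) \<in> Eq f \<and> d \<in> {- 1, 1}) \<and>
    left_word M = u \<and> right_word M = v"
  using assms
proof (induction u arbitrary: v)
  case Nil
  then show ?case by (intro exI[of _ "[]"]) (auto simp: symmetric_words_def left_word_def right_word_def)
next
  case (Cons l u)
  obtain a e where l: "l = (a, e)" by force
  obtain b v' where v: "v = (b, e) # v'" "(a, b) \<in> Eq f" "(u, v') \<in> symmetric_words f"
    using Cons.prems word_map_eq_Cons[of f v "arr f a" e "word_map f u"]
    by (auto simp: symmetric_words_def l Eq_def)
  obtain M where "\<forall>(a, b, d) \<in> set M. (a, b) \<in> Eq f \<and> d \<in> {- 1, 1}"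
    "left_word M = u" "right_word M = v'" using Cons.IH[OF v(3)] by blast
  then show ?case
    using v by (intro exI[of _ "(a, b, if e then 1 else - 1) # M"])
      (auto simp: l left_word_def right_word_def)
qed

lemma horn_symmetric_words:
  assumes "\<forall>(a, b, d) \<in> set M. (a, b) \<in> Eq f \<and> d \<in> {- 1, 1}"
  shows "(left_word M, right_word M) \<in> symmetric_words f"
  using assms
  by (induction M) (auto simp: symmetric_words_def left_word_def right_word_def Eq_def)

text \<open>The letters are only required to lie in \<open>X\<close>, so that the result applies to horns as well as to
  the lists which define symmetric paths.\<close>

lemma (in rack) horn_paths:
  assumes "\<forall>(a, b, d) \<in> set M. a \<in> carrier X \<and> b \<in> carrier X \<and> d \<in> {- 1, 1}"
  shows "left_path X M = path_equiv X `` {left_word M}" "left_word M \<in> words X"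
    and "right_path X M = path_equiv X `` {right_word M}" "right_word M \<in> words X"
proof -
  let ?L = "map (\<lambda>(a, b, d). (a, d)) M" and ?R = "map (\<lambda>(a, b, d). (b, d)) M"
  have *: "map (\<lambda>(a, d). (a, d = 1)) ?L = left_word M" "map (\<lambda>(a, d). (a, d = 1)) ?R = right_word M"
    by (simp_all add: left_word_def right_word_def case_prod_unfold)
  have "\<forall>(a, d) \<in> set ?L. a \<in> carrier X \<and> d \<in> {- 1, 1}" "\<forall>(a, d) \<in> set ?R. a \<in> carrier X \<and> d \<in> {- 1, 1}"
    using assms by auto
  from this[THEN path_prod_word, unfolded *]
  show "left_path X M = path_equiv X `` {left_word M}" "left_word M \<in> words X"
    and "right_path X M = path_equiv X `` {right_word M}" "right_word M \<in> words X"
    by (simp_all add: left_path_def right_path_def)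
qed

section \<open>Symmetric paths and the kernel\<close>

locale rack_extension =
  fixes f :: "('a, 'b) rack_arrow"
  assumes extension_f: "extension f"
begin

abbreviation A where "A \<equiv> src f"
abbreviation B where "B \<equiv> tgt f"

sublocale A: rack A using extension_f by (simp add: extension_def)
sublocale B: rack B using extension_f by (simp add: extension_def)
sublocale PA: group "Pth A" by (rule group_Pth[OF A.rack_axioms])
sublocale PB: group "Pth B" by (rule group_Pth[OF B.rack_axioms])

lemma arr_hom: "arr f \<in> rack_hom A B"
  and arr_surj: "arr f ` carrier A = carrier B"
  using extension_f by (auto simp: extension_def)

lemmas arr_closed = rack_hom_closed[OF arr_hom]

lemma word_map_words: "w \<in> words A \<Longrightarrow> word_map f w \<in> words B"
  by (induction w) (auto simp: arr_closed)

lemma words_surj: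
  assumes "w \<in> words B"
  shows "\<exists>u \<in> words A. word_map f u = w"
  using assms
proof (induction w)
  case (Cons l w)
  have "w \<in> words B" using Cons.prems by (cases l) simp
  then obtain u where u: "u \<in> words A" "word_map f u = w" using Cons.IH by blast
  obtain b e where l: "l = (b, e)" by force
  then have "b \<in> carrier B" using Cons.prems by simp
  then obtain a where "a \<in> carrier A" "arr f a = b" using arr_surj by (metis imageE)
  then show ?case using u by (intro bexI[of _ "(a, e) # u"]) (simp_all add: l)
qed simp

text \<open>This is the functoriality of \<open>Pth\<close>: \<open>f\<close> carries the defining relations of \<open>Pth(A)\<close> to defining
  relations of \<open>Pth(B)\<close>.\<close>

lemma word_map_equiv: "(u, v) \<in> path_equiv A \<Longrightarrow> (word_map f u, word_map f v) \<in> path_equiv B"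
  unfolding path_equiv_def
proof (induction rule: word_equiv.induct)
  case (refl w)
  then have "word_map f w \<in> words B" by (intro word_map_words) (simp add: words_def)
  then show ?case by (intro word_equiv.refl) (simp add: words_def)
next
  case (cancel s e)
  then show ?case by (auto intro: word_equiv.cancel arr_closed)
next
  case (relation u v)
  then have "word_map f u \<in> words B" "word_map f v \<in> words B"
    by (auto simp only: words_def[symmetric] intro: word_map_words)
  then show ?case using relation(1)
    by (intro word_equiv.relation)
      (auto simp: words_def rack_hom_op[OF arr_hom] intro: arr_closed)
qed (auto intro: word_equiv.sym word_equiv.trans word_equiv.append)

lemma Pth_map_class:
  assumes w: "w \<in> words A"
  shows "Pth_map f (path_equiv A `` {w}) = path_equiv B `` {word_map f w}"
proof -
  have "(\<lambda>v. path_equiv B `` {word_map f v}) respects path_equiv A"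
    by (rule congruentI) (intro equiv_class_eq[OF path_equiv_equiv[OF B.rack_axioms]] word_map_equiv)
  from UN_equiv_class[OF path_equiv_equiv[OF A.rack_axioms] this w]
  show ?thesis using A.path_closed[OF w] by (simp add: Pth_map_def word_map_def)
qed

lemma Pth_map_hom: "Pth_map f \<in> hom (Pth A) (Pth B)"
  by (rule homI) (auto simp: Pth_carrier Pth_map_class Pth_mult[OF A.rack_axioms] word_map_words
      Pth_mult[OF B.rack_axioms])

sublocale Pth_map: group_hom "Pth A" "Pth B" "Pth_map f"
  by unfold_locales (rule Pth_map_hom)

abbreviation path where "path w \<equiv> path_equiv A `` {w}"

text \<open>The word-level form of the group of symmetric paths, in which corresponding letters have the same
  image in \<open>B\<close> and not merely in \<open>Pth(B)\<close>.\<close>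

definition symmetric_quotients :: "('a \<times> bool) list set set" where
  "symmetric_quotients = {path (u @ word_inv v) | u v. (u, v) \<in> symmetric_words f}"

lemma symmetric_quotientsI:
  "(u, v) \<in> symmetric_words f \<Longrightarrow> path (u @ word_inv v) \<in> symmetric_quotients"
  by (auto simp: symmetric_quotients_def)

lemma symmetric_words_append:
  "(u, v) \<in> symmetric_words f \<Longrightarrow> (u', v') \<in> symmetric_words f \<Longrightarrow>
   (u @ u', v @ v') \<in> symmetric_words f"
  by (auto simp: symmetric_words_def)

lemma symmetric_words_sym: "(u, v) \<in> symmetric_words f \<Longrightarrow> (v, u) \<in> symmetric_words f"
  by (auto simp: symmetric_words_def)

lemma symmetric_words_refl: "u \<in> words A \<Longrightarrow> (u, u) \<in> symmetric_words f"
  by (auto simp: symmetric_words_def)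

lemma symmetric_words_inv:
  "(u, v) \<in> symmetric_words f \<Longrightarrow> (word_inv u, word_inv v) \<in> symmetric_words f"
  by (auto simp: symmetric_words_def word_inv_words word_map_inv)

lemma symmetric_words_words: "(u, v) \<in> symmetric_words f \<Longrightarrow> u \<in> words A \<and> v \<in> words A"
  by (auto simp: symmetric_words_def)

lemma symmetric_words_path:
  "(u, v) \<in> symmetric_words f \<Longrightarrow> path (u @ word_inv v) = path u \<otimes>\<^bsub>Pth A\<^esub> inv\<^bsub>Pth A\<^esub> path v"
  by (auto dest!: symmetric_words_words simp: A.path_inv Pth_mult[OF A.rack_axioms] word_inv_words)

text \<open>For the product, \<open>u v\<inverse> u' v'\<inverse>\<close> has to be written as one quotient of symmetric words:
  inserting the trivial path \<open>v v\<inverse>\<close> gives \<open>(u v\<inverse> u') (v v\<inverse> v')\<inverse>\<close>, whose two sides are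
  symmetric letter by letter.\<close>

lemma symmetric_quotients_subgroup: "subgroup symmetric_quotients (Pth A)"
proof (rule PA.subgroupI)
  show "symmetric_quotients \<subseteq> carrier (Pth A)"
    by (auto simp: symmetric_quotients_def word_inv_words intro!: A.path_closed dest!: symmetric_words_words)
  show "symmetric_quotients \<noteq> {}"
    using symmetric_quotientsI[OF symmetric_words_refl[of "[]"]] by auto
  fix g assume "g \<in> symmetric_quotients"
  then obtain u v where g: "g = path (u @ word_inv v)" and uv: "(u, v) \<in> symmetric_words f"
    by (auto simp: symmetric_quotients_def)
  have "inv\<^bsub>Pth A\<^esub> g = path (v @ word_inv u)"
    using symmetric_words_words[OF uv] by (simp add: g A.path_inv word_inv_words)
  then show "inv\<^bsub>Pth A\<^esub> g \<in> symmetric_quotients"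
    using symmetric_quotientsI[OF symmetric_words_sym[OF uv]] by simp
  fix h assume "h \<in> symmetric_quotients"
  then obtain u' v' where h: "h = path (u' @ word_inv v')" and uv': "(u', v') \<in> symmetric_words f"
    by (auto simp: symmetric_quotients_def)
  note w = symmetric_words_words[OF uv] symmetric_words_words[OF uv']
  let ?p = "u @ word_inv v @ u'" and ?q = "v @ word_inv v @ v'"
  have pq: "(?p, ?q) \<in> symmetric_words f"
    using w by (intro symmetric_words_append uv uv' symmetric_words_refl word_inv_words) simp
  have "path (?p @ word_inv ?q) = path ?p \<otimes>\<^bsub>Pth A\<^esub> inv\<^bsub>Pth A\<^esub> path ?q"
    by (rule symmetric_words_path[OF pq])
  also have "path ?q = path v'"
    using w by (simp flip: Pth_mult[OF A.rack_axioms] A.path_inv add: word_inv_words A.path_closed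
        PA.cancel_left)
  also have "path ?p \<otimes>\<^bsub>Pth A\<^esub> inv\<^bsub>Pth A\<^esub> path v' = g \<otimes>\<^bsub>Pth A\<^esub> h"
    using w by (simp add: g h A.path_inv Pth_mult[OF A.rack_axioms] word_inv_words)
  finally show "g \<otimes>\<^bsub>Pth A\<^esub> h \<in> symmetric_quotients"
    using symmetric_quotientsI[OF pq] by simp
qed

text \<open>Prefixing both words by \<open>w\<close> keeps them symmetric: \<open>w (u v\<inverse>) w\<inverse> = (w u) (w v)\<inverse>\<close>.\<close>

lemma symmetric_quotients_conj:
  assumes "w \<in> words A" "g \<in> symmetric_quotients"
  shows "path w \<otimes>\<^bsub>Pth A\<^esub> g \<otimes>\<^bsub>Pth A\<^esub> inv\<^bsub>Pth A\<^esub> path w \<in> symmetric_quotients"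
proof -
  obtain u v where g: "g = path (u @ word_inv v)" and uv: "(u, v) \<in> symmetric_words f"
    using assms(2) by (auto simp: symmetric_quotients_def)
  have "path w \<otimes>\<^bsub>Pth A\<^esub> g \<otimes>\<^bsub>Pth A\<^esub> inv\<^bsub>Pth A\<^esub> path w = path ((w @ u) @ word_inv (w @ v))"
    using assms(1) symmetric_words_words[OF uv]
    by (simp add: g A.path_inv Pth_mult[OF A.rack_axioms] word_inv_words)
  then show ?thesis
    using symmetric_quotientsI[OF symmetric_words_append[OF symmetric_words_refl[OF assms(1)] uv]] by simp
qed

text \<open>The core of the description of the kernel, by induction on the derivation of the equivalence of
  \<open>s\<close> and \<open>t\<close> in \<open>Pth(B)\<close>. All lifts are considered at once, because the two sides of a rule of
  derivation impose no common choice of lift. Surjectivity of \<open>f\<close> enters for transitivity, where a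
  lift of the middle word is needed.\<close>

lemma lifts_of_equivalent_words:
  assumes "(s, t) \<in> path_equiv B"
    and "u \<in> words A" "v \<in> words A" "word_map f u = s" "word_map f v = t"
  shows "path u \<otimes>\<^bsub>Pth A\<^esub> inv\<^bsub>Pth A\<^esub> path v \<in> symmetric_quotients"
proof -
  interpret N: subgroup symmetric_quotients "Pth A" by (rule symmetric_quotients_subgroup)
  let ?D = "\<lambda>u v. path u \<otimes>\<^bsub>Pth A\<^esub> inv\<^bsub>Pth A\<^esub> path v"
  have same: "?D u v \<in> symmetric_quotients"
    if "u \<in> words A" "v \<in> words A" "word_map f u = word_map f v" for u v
  proof -
    have "(u, v) \<in> symmetric_words f" using that by (simp add: symmetric_words_def)
    from symmetric_quotientsI[OF this] symmetric_words_path[OF this] show ?thesis by simp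
  qed
  have tr: "?D u w \<in> symmetric_quotients"
    if "?D u v \<in> symmetric_quotients" "?D v w \<in> symmetric_quotients"
      "u \<in> words A" "v \<in> words A" "w \<in> words A" for u v w
  proof -
    have "?D u w = ?D u v \<otimes>\<^bsub>Pth A\<^esub> ?D v w"
      using that(3-5) by (simp add: A.path_closed PA.m_assoc PA.cancel_left)
    then show ?thesis using N.m_closed[OF that(1,2)] by simp
  qed
  have "(s, t) \<in> word_equiv (carrier B)
     {([(x \<triangleleft>\<^bsub>B\<^esub> a, True)], [(a, False), (x, True), (a, True)]) | x a.
        x \<in> carrier B \<and> a \<in> carrier B}"
    using assms(1) by (simp add: path_equiv_def)
  then show ?thesis using assms(2-)
  proof (induction arbitrary: u v rule: word_equiv.induct)
    case (refl w)
    then show ?case by (intro same) simp_all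
  next
    case (sym s t)
    have "?D u v = inv\<^bsub>Pth A\<^esub> ?D v u"
      using sym.prems by (simp add: A.path_closed PA.inv_mult_group)
    then show ?case using N.m_inv_closed[OF sym.IH[of v u]] sym.prems by simp
  next
    case (trans s t r)
    have "t \<in> words B" using trans.hyps(1) path_equiv_words[of s t B] by (simp add: path_equiv_def)
    then obtain w where "w \<in> words A" "word_map f w = t" using words_surj by blast
    then show ?case using trans.IH(1)[of u w] trans.IH(2)[of w v] trans.prems by (intro tr[of u w v])
  next
    case (append s s' t t')
    obtain u1 u2 where u: "u = u1 @ u2" "word_map f u1 = s" "word_map f u2 = t"
      using append.prems(3) by (metis word_map_eq_append)
    obtain v1 v2 where v: "v = v1 @ v2" "word_map f v1 = s'" "word_map f v2 = t'"
      using append.prems(4) by (metis word_map_eq_append)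
    have w: "u1 \<in> words A" "u2 \<in> words A" "v1 \<in> words A" "v2 \<in> words A"
      using append.prems(1,2) by (simp_all add: u v)
    \<comment> \<open>Normality moves the difference of the tails past the head \<open>u1\<close>.\<close>
    have "?D u v = (path u1 \<otimes>\<^bsub>Pth A\<^esub> ?D u2 v2 \<otimes>\<^bsub>Pth A\<^esub> inv\<^bsub>Pth A\<^esub> path u1) \<otimes>\<^bsub>Pth A\<^esub> ?D u1 v1"
      using w by (simp add: u v A.path_closed PA.m_assoc PA.cancel_left PA.inv_mult_group
          flip: Pth_mult[OF A.rack_axioms])
    then show ?case
      using N.m_closed[OF symmetric_quotients_conj[OF w(1) append.IH(2)[OF w(2,4) u(3) v(3)]]
          append.IH(1)[OF w(1,3) u(2) v(2)]] by simp
  next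
    case (cancel s e)
    obtain a b where u: "u = [(a, e), (b, \<not> e)]" and ab: "a \<in> carrier A" "b \<in> carrier A"
        "arr f a = arr f b" and v: "v = []"
      using cancel.prems by (auto simp: word_map_eq_Cons)
    \<comment> \<open>The two letters of a lift may differ; replacing \<open>a\<close> by \<open>b\<close> makes them cancel.\<close>
    have "path [(b, e), (b, \<not> e)] = path v"
      using ab word_equiv.cancel[OF ab(2), of e] A.path_eq_iff[of "[(b, e), (b, \<not> e)]" "[]"]
      by (simp add: v path_equiv_def)
    then show ?case using same[of u "[(b, e), (b, \<not> e)]"] ab by (simp add: u)
  next
    case (relation s t)
    then obtain x a where xa: "s = [(x \<triangleleft>\<^bsub>B\<^esub> a, True)]" "t = [(a, False), (x, True), (a, True)]"
      by blast
    obtain a1 x' a2 where v: "v = [(a1, False), (x', True), (a2, True)]"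
        and m: "a1 \<in> carrier A" "x' \<in> carrier A" "a2 \<in> carrier A"
        and i: "arr f a1 = a" "arr f x' = x" "arr f a2 = a"
      using relation.prems by (auto simp: xa word_map_eq_Cons)
    \<comment> \<open>The outer letters \<open>a1\<close>, \<open>a2\<close> of the lift may differ as well; making them equal gives a
      defining relation of \<open>Pth(A)\<close>, whose other side \<open>?v1\<close> has the same image as \<open>u\<close>.\<close>
    let ?v1 = "[(x' \<triangleleft>\<^bsub>A\<^esub> a1, True)]" and ?v2 = "[(a1, False), (x', True), (a1, True)]"
    have w: "?v1 \<in> words A" "?v2 \<in> words A" using m by (simp_all add: A.op_closed)
    have "(?v1, ?v2) \<in> path_equiv A" unfolding path_equiv_def
      using w m by (intro word_equiv.relation) (auto simp: words_def)
    then have e: "path ?v1 = path ?v2" using w by (simp add: A.path_eq_iff)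
    have "?D u ?v1 \<in> symmetric_quotients"
      using relation.prems w m i by (intro same) (simp_all add: xa rack_hom_op[OF arr_hom])
    then have "?D u ?v2 \<in> symmetric_quotients" unfolding e .
    moreover have "?D ?v2 v \<in> symmetric_quotients"
      using relation.prems w i by (intro same) (simp_all add: v)
    ultimately show ?case by (rule tr) (fact relation.prems w)+
  qed
qed

lemma kernel_subset: "kernel (Pth A) (Pth B) (Pth_map f) \<subseteq> symmetric_quotients"
proof
  fix g assume "g \<in> kernel (Pth A) (Pth B) (Pth_map f)"
  then obtain w where w: "w \<in> words A" "g = path w" and "Pth_map f g = \<one>\<^bsub>Pth B\<^esub>"
    by (auto simp: kernel_def Pth_carrier)
  then have "(word_map f w, []) \<in> path_equiv B"
    using word_map_words[OF w(1)] by (simp add: Pth_map_class B.path_one B.path_eq_iff)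
  from lifts_of_equivalent_words[OF this w(1), of "[]"]
  have "path w \<otimes>\<^bsub>Pth A\<^esub> inv\<^bsub>Pth A\<^esub> \<one>\<^bsub>Pth A\<^esub> \<in> symmetric_quotients"
    by (simp add: A.path_one)
  then show "g \<in> symmetric_quotients" using w by (simp add: A.path_closed)
qed

lemma symmetric_quotients_subset: "symmetric_quotients \<subseteq> symmetric_paths f"
proof
  fix g assume "g \<in> symmetric_quotients"
  then obtain u v where g: "g = path (u @ word_inv v)" and uv: "(u, v) \<in> symmetric_words f"
    by (auto simp: symmetric_quotients_def)
  obtain M where M: "\<forall>(a, b, d) \<in> set M. (a, b) \<in> Eq f \<and> d \<in> {- 1, 1}"
    and w: "left_word M = u" "right_word M = v" using symmetric_words_horn[OF uv] by blast
  have M': "\<forall>(a, b, d) \<in> set M. a \<in> carrier A \<and> b \<in> carrier A \<and> d \<in> {- 1, 1} \<and>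
      Pth_map f (path_gen A a) = Pth_map f (path_gen A b)"
    using M by (auto simp: Eq_def path_gen_def Pth_map_class)
  then have "\<forall>(a, b, d) \<in> set M. a \<in> carrier A \<and> b \<in> carrier A \<and> d \<in> {- 1, 1}"
    by auto
  from A.horn_paths[OF this]
  have "g = left_path A M \<otimes>\<^bsub>Pth A\<^esub> inv\<^bsub>Pth A\<^esub> right_path A M"
    by (simp add: g w symmetric_words_path[OF uv])
  then show "g \<in> symmetric_paths f" using M' unfolding symmetric_paths_def by blast
qed

text \<open>Symmetric paths only ask that corresponding generators agree in \<open>Pth(B)\<close>, which is weaker than
  \<open>Eq f\<close> since distinct elements of a rack may define the same generator. It still forces the two
  products to have the same image, so no path outside the kernel is gained.\<close>

lemma symmetric_paths_subset: "symmetric_paths f \<subseteq> kernel (Pth A) (Pth B) (Pth_map f)"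
proof
  fix g assume "g \<in> symmetric_paths f"
  then obtain M where g: "g = left_path A M \<otimes>\<^bsub>Pth A\<^esub> inv\<^bsub>Pth A\<^esub> right_path A M"
    and M: "\<forall>(a, b, d) \<in> set M. a \<in> carrier A \<and> b \<in> carrier A \<and> d \<in> {- 1, 1} \<and>
      Pth_map f (path_gen A a) = Pth_map f (path_gen A b)"
    unfolding symmetric_paths_def by blast
  have "left_path A M \<in> carrier (Pth A) \<and> right_path A M \<in> carrier (Pth A) \<and>
      Pth_map f (left_path A M) = Pth_map f (right_path A M)"
    using M
  proof (induction M)
    case Nil
    then show ?case by (simp add: left_path_def right_path_def path_prod_def)
  next
    case (Cons m M)
    obtain a b d where m: "m = (a, b, d)" by (metis prod.exhaust)
    then have ab: "a \<in> carrier A" "b \<in> carrier A" "Pth_map f (path_gen A a) = Pth_map f (path_gen A b)"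
      using Cons.prems by auto
    then have "Pth_map f (path_gen A a [^]\<^bsub>Pth A\<^esub> d) = Pth_map f (path_gen A b [^]\<^bsub>Pth A\<^esub> d)"
      by (simp add: Pth_map.hom_int_pow path_gen_closed)
    then show ?case using Cons ab
      by (simp add: m left_path_def right_path_def path_prod_def path_gen_closed)
  qed
  then show "g \<in> kernel (Pth A) (Pth B) (Pth_map f)"
    by (simp add: g kernel_def)
qed

lemma kernel_eq_symmetric_paths: "kernel (Pth A) (Pth B) (Pth_map f) = symmetric_paths f"
  and symmetric_paths_eq: "symmetric_paths f = symmetric_quotients"
  using kernel_subset symmetric_quotients_subset symmetric_paths_subset by blast+

end

section \<open>The centralizing congruence\<close>

text \<open>The horn relation of the second description, with the two sides of a horn given as words.\<close>

definition horn_endpoints :: "('a, 'b) rack_arrow \<Rightarrow> ('a \<times> 'a) set" where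
  "horn_endpoints f = {(word_act (src f) x u, word_act (src f) x v) | x u v.
     x \<in> carrier (src f) \<and> (u, v) \<in> symmetric_words f}"

context rack_extension
begin

abbreviation act (infixl \<open>\<cdot>\<close> 70) where "x \<cdot> w \<equiv> word_act A x w"

lemma arr_word_act:
  assumes "w \<in> words A" "x \<in> carrier A"
  shows "arr f (x \<cdot> w) = word_act B (arr f x) (word_map f w)"
  using assms
proof (induction w arbitrary: x)
  case (Cons l w)
  obtain a e where "l = (a, e)" by force
  then show ?case
    using Cons A.op_closed A.inv_closed
    by (simp add: word_act_def rack_hom_op[OF arr_hom] rack_hom_inv[OF arr_hom])
qed (simp add: word_act_def)

lemma horn_endpointsI:
  "x \<in> carrier A \<Longrightarrow> (u, v) \<in> symmetric_words f \<Longrightarrow> (x \<cdot> u, x \<cdot> v) \<in> horn_endpoints f"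
  by (auto simp: horn_endpoints_def)

lemma horn_endpointsE:
  assumes "(a, b) \<in> horn_endpoints f"
  obtains x u v where "x \<in> carrier A" "(u, v) \<in> symmetric_words f"
    "u \<in> words A" "v \<in> words A" "a = x \<cdot> u" "b = x \<cdot> v"
  using assms symmetric_words_words unfolding horn_endpoints_def by blast

lemma horn_endpoints_Eq: "horn_endpoints f \<subseteq> Eq f"
proof clarify
  fix a b assume "(a, b) \<in> horn_endpoints f"
  then show "(a, b) \<in> Eq f"
    by (elim horn_endpointsE)
      (simp add: Eq_def word_act_closed[OF A.rack_axioms] arr_word_act symmetric_words_def)
qed

text \<open>Transitivity: horns from \<open>a = x \<cdot> u\<close> to \<open>b = x \<cdot> v\<close> and from \<open>b = y \<cdot> u'\<close> to \<open>c = y \<cdot> v'\<close> are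
  joined by travelling from \<open>b\<close> back along \<open>u'\<close> to \<open>y\<close>. The other side of the new horn must run
  through symmetric letters and end at \<open>a\<close>, which the detour \<open>u'\<inverse> u'\<close> after \<open>u\<close> achieves.\<close>

lemma horn_endpoints_equiv: "equiv (carrier A) (horn_endpoints f)"
proof (rule equivI)
  show "horn_endpoints f \<subseteq> carrier A \<times> carrier A"
    using horn_endpoints_Eq by (auto simp: Eq_def)
  show "refl_on (carrier A) (horn_endpoints f)"
  proof (rule refl_onI)
    fix x assume "x \<in> carrier A"
    then show "(x, x) \<in> horn_endpoints f"
      using horn_endpointsI[OF _ symmetric_words_refl[of "[]"]] by (simp add: word_act_def)
  qed
  show "sym (horn_endpoints f)"
    by (rule symI) (elim horn_endpointsE, simp add: horn_endpointsI symmetric_words_sym)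
  show "trans (horn_endpoints f)"
  proof (rule transI)
    fix a b c assume "(a, b) \<in> horn_endpoints f" "(b, c) \<in> horn_endpoints f"
    then obtain x u v y u' v' where x: "x \<in> carrier A" "(u, v) \<in> symmetric_words f"
        "u \<in> words A" "v \<in> words A" "a = x \<cdot> u" "b = x \<cdot> v"
      and y: "y \<in> carrier A" "(u', v') \<in> symmetric_words f"
        "u' \<in> words A" "v' \<in> words A" "b = y \<cdot> u'" "c = y \<cdot> v'"
      by (elim horn_endpointsE)
    let ?p = "u @ word_inv u' @ u'" and ?q = "v @ word_inv u' @ v'"
    have "(?p, ?q) \<in> symmetric_words f"
      using x(2) y(2,3) by (intro symmetric_words_append symmetric_words_refl word_inv_words)
    from horn_endpointsI[OF x(1) this] have "(x \<cdot> ?p, x \<cdot> ?q) \<in> horn_endpoints f" .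
    moreover have "x \<cdot> ?p = a"
      using x y by (simp add: word_act_append A.word_act_inv word_act_closed[OF A.rack_axioms])
    moreover have "x \<cdot> ?q = c"
      using y by (simp add: word_act_append A.word_act_inv flip: x(6))
    ultimately show "(a, c) \<in> horn_endpoints f" by simp
  qed
qed

abbreviation C1_pairs where
  "C1_pairs \<equiv> {((x \<triangleleft>\<^bsub>A\<^esub> a) \<triangleleft>\<inverse>\<^bsub>A\<^esub> b, x) | x a b. x \<in> carrier A \<and> (a, b) \<in> Eq f}"

lemma C1_equiv: "equiv (carrier A) (C1 f)"
  unfolding C1_def
  by (rule generated_equiv_equiv) (auto simp: Eq_def intro: A.op_closed A.inv_closed)

lemma C1_pair: "x \<in> carrier A \<Longrightarrow> (a, b) \<in> Eq f \<Longrightarrow> ((x \<triangleleft>\<^bsub>A\<^esub> a) \<triangleleft>\<inverse>\<^bsub>A\<^esub> b, x) \<in> C1 f"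
  unfolding C1_def by (rule set_mp[OF generated_equiv_base]) blast

text \<open>Starting at \<open>x\<close>, the words \<open>a b\<inverse>\<close> and \<open>b b\<inverse>\<close> are symmetric and end at \<open>(x \<triangleleft> a) \<triangleleft>\<inverse> b\<close> and at
  \<open>x\<close>.\<close>

lemma C1_subset_horn_endpoints: "C1 f \<subseteq> horn_endpoints f"
  unfolding C1_def
proof (rule generated_equiv_least[OF horn_endpoints_equiv], clarify)
  fix x a b assume x: "x \<in> carrier A" and ab: "(a, b) \<in> Eq f"
  then have m: "a \<in> carrier A" "b \<in> carrier A" by (simp_all add: Eq_def)
  let ?u = "[(a, True), (b, False)]" and ?v = "[(b, True), (b, False)]"
  have "(?u, ?v) \<in> symmetric_words f" using ab by (auto simp: symmetric_words_def Eq_def)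
  from horn_endpointsI[OF x this]
  show "((x \<triangleleft>\<^bsub>A\<^esub> a) \<triangleleft>\<inverse>\<^bsub>A\<^esub> b, x) \<in> horn_endpoints f"
    using x m by (simp add: word_act_def A.op_inv)
qed

text \<open>A word acts as an automorphism of the rack and maps pairs in \<open>Eq f\<close> to pairs in \<open>Eq f\<close>, so it
  maps generating pairs of \<open>C1 f\<close> to generating pairs.\<close>

lemma C1_word_act:
  assumes w: "w \<in> words A" and "(x, y) \<in> C1 f"
  shows "(x \<cdot> w, y \<cdot> w) \<in> C1 f"
proof -
  let ?R = "{(x, y). x \<in> carrier A \<and> y \<in> carrier A \<and> (x \<cdot> w, y \<cdot> w) \<in> C1 f}"
  note closed = word_act_closed[OF A.rack_axioms w]
  have "equiv (carrier A) ?R"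
  proof (rule equivI)
    show "refl_on (carrier A) ?R"
      using C1_equiv closed by (auto simp: refl_on_def equiv_def)
    show "sym ?R" using equiv_sym_on[OF C1_equiv] by (auto simp: sym_def)
    show "trans ?R" using equiv_trans_on[OF C1_equiv] by (auto intro!: transI dest: transD)
  qed auto
  moreover have "C1_pairs \<subseteq> ?R"
  proof clarify
    fix x a b assume x: "x \<in> carrier A" and ab: "(a, b) \<in> Eq f"
    then have m: "a \<in> carrier A" "b \<in> carrier A" by (simp_all add: Eq_def)
    have op_inv: "(s \<triangleleft>\<inverse>\<^bsub>A\<^esub> t) \<cdot> w = (s \<cdot> w) \<triangleleft>\<inverse>\<^bsub>A\<^esub> (t \<cdot> w)"
      if "s \<in> carrier A" "t \<in> carrier A" for s t
      using A.self_action.act_op_inv[OF A.path_closed[OF w] that]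
      by (simp add: A.self_action.act_class w that A.inv_closed)
    have "(a \<cdot> w, b \<cdot> w) \<in> Eq f"
      using ab w closed by (simp add: Eq_def arr_word_act)
    from C1_pair[OF closed[OF x] this]
    have "(((x \<triangleleft>\<^bsub>A\<^esub> a) \<triangleleft>\<inverse>\<^bsub>A\<^esub> b) \<cdot> w, x \<cdot> w) \<in> C1 f"
      using x m by (simp add: op_inv A.self_action.word_act_op[OF w] A.op_closed)
    then show "(x \<triangleleft>\<^bsub>A\<^esub> a) \<triangleleft>\<inverse>\<^bsub>A\<^esub> b \<in> carrier A \<and> x \<in> carrier A \<and>
        (((x \<triangleleft>\<^bsub>A\<^esub> a) \<triangleleft>\<inverse>\<^bsub>A\<^esub> b) \<cdot> w, x \<cdot> w) \<in> C1 f"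
      using x m by (simp add: A.op_closed A.inv_closed)
  qed
  ultimately have "C1 f \<subseteq> ?R" unfolding C1_def by (rule generated_equiv_least)
  then show ?thesis using assms(2) by blast
qed

text \<open>The letters are exchanged one at a time. When the letter is positive, \<open>x \<triangleleft> a\<close> is the
  image under \<open>b\<close> of the first half of the generating pair \<open>((x \<triangleleft> a) \<triangleleft>\<inverse> b, x)\<close>; when it is
  negative, \<open>(x \<triangleleft>\<inverse> a, x \<triangleleft>\<inverse> b)\<close> is itself a generating pair, the one for the start \<open>x \<triangleleft>\<inverse> b\<close> and
  the pair \<open>(b, a)\<close>.\<close>

lemma symmetric_words_C1:
  assumes "(u, v) \<in> symmetric_words f" "x \<in> carrier A"
  shows "(x \<cdot> u, x \<cdot> v) \<in> C1 f"
  using assms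
proof (induction u arbitrary: v x)
  case Nil
  then show ?case
    using C1_equiv by (simp add: symmetric_words_def word_act_def equiv_def refl_on_def)
next
  case (Cons l u)
  obtain a e where l: "l = (a, e)" by force
  obtain b v' where v: "v = (b, e) # v'" and ab: "(a, b) \<in> Eq f" and uv: "(u, v') \<in> symmetric_words f"
    using Cons.prems(1) word_map_eq_Cons[of f v "arr f a" e "word_map f u"]
    by (auto simp: symmetric_words_def l Eq_def)
  have m: "a \<in> carrier A" "b \<in> carrier A" and ba: "(b, a) \<in> Eq f" using ab by (simp_all add: Eq_def)
  have v': "v' \<in> words A" using symmetric_words_words[OF uv] by simp
  let ?s = "\<lambda>c. x \<cdot> [(c, e)]"
  have s: "?s c \<in> carrier A" if "c \<in> carrier A" for c
    using that Cons.prems(2) by (intro word_act_closed[OF A.rack_axioms]) simp_all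
  have "(?s a, ?s b) \<in> C1 f"
  proof (cases e)
    case True
    have x': "(x \<triangleleft>\<^bsub>A\<^esub> a) \<triangleleft>\<inverse>\<^bsub>A\<^esub> b \<in> carrier A" "x \<triangleleft>\<^bsub>A\<^esub> a \<in> carrier A"
      using Cons.prems(2) m by (simp_all add: A.op_closed A.inv_closed)
    have "(((x \<triangleleft>\<^bsub>A\<^esub> a) \<triangleleft>\<inverse>\<^bsub>A\<^esub> b) \<cdot> [(b, True)], x \<cdot> [(b, True)]) \<in> C1 f"
      using m by (intro C1_word_act C1_pair Cons.prems(2) ab) simp
    then show ?thesis using True x' m by (simp add: word_act_def A.inv_op)
  next
    case False
    have "(((x \<triangleleft>\<inverse>\<^bsub>A\<^esub> b) \<triangleleft>\<^bsub>A\<^esub> b) \<triangleleft>\<inverse>\<^bsub>A\<^esub> a, x \<triangleleft>\<inverse>\<^bsub>A\<^esub> b) \<in> C1 f"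
      using Cons.prems(2) m by (intro C1_pair ba A.inv_closed)
    then show ?thesis using False Cons.prems(2) m by (simp add: word_act_def A.inv_op)
  qed
  then have "(?s a \<cdot> v', ?s b \<cdot> v') \<in> C1 f" by (rule C1_word_act[OF v'])
  moreover have "(?s a \<cdot> u, ?s a \<cdot> v') \<in> C1 f" by (rule Cons.IH[OF uv s[OF m(1)]])
  ultimately have "(?s a \<cdot> u, ?s b \<cdot> v') \<in> C1 f"
    using equiv_trans_on[OF C1_equiv] by (blast dest: transD)
  then show ?case by (simp add: l v word_act_def)
qed

lemma C1_eq_horn_endpoints: "C1 f = horn_endpoints f"
  using C1_subset_horn_endpoints symmetric_words_C1 by (auto elim!: horn_endpointsE)

lemma C1_subset_Eq: "C1 f \<subseteq> Eq f"
  using horn_endpoints_Eq by (simp add: C1_eq_horn_endpoints)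

text \<open>Acting by related letters extends the horn by one step on both sides; this is where
  \<open>C1 f \<subseteq> Eq f\<close> is used.\<close>

lemma C1_congruence: "rack_congruence A (C1 f)"
proof -
  have "(x \<triangleleft>\<^bsub>A\<^esub> y, x' \<triangleleft>\<^bsub>A\<^esub> y') \<in> C1 f \<and> (x \<triangleleft>\<inverse>\<^bsub>A\<^esub> y, x' \<triangleleft>\<inverse>\<^bsub>A\<^esub> y') \<in> C1 f"
    if xx: "(x, x') \<in> C1 f" and yy: "(y, y') \<in> C1 f" for x x' y y'
  proof -
    obtain z u v where z: "z \<in> carrier A" "(u, v) \<in> symmetric_words f" "x = z \<cdot> u" "x' = z \<cdot> v"
      using xx unfolding C1_eq_horn_endpoints by (elim horn_endpointsE)
    have "([(y, e)], [(y', e)]) \<in> symmetric_words f" for e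
      using set_mp[OF C1_subset_Eq yy] by (simp add: symmetric_words_def Eq_def)
    then have "(z \<cdot> (u @ [(y, e)]), z \<cdot> (v @ [(y', e)])) \<in> C1 f" for e
      by (intro symmetric_words_C1 symmetric_words_append z)
    from this[of True] this[of False] show ?thesis
      by (simp add: z(3,4) word_act_append) (simp add: word_act_def)
  qed
  then show ?thesis using C1_equiv unfolding rack_congruence_def by blast
qed

lemma C1_iff_horn:
  "(a, b) \<in> C1 f \<longleftrightarrow>
   (\<exists>x M. is_horn f (x, M) \<and> path_act A x (left_path A M) = a \<and> path_act A x (right_path A M) = b)"
proof -
  have ends: "(left_word M, right_word M) \<in> symmetric_words f \<and>
      path_act A x (left_path A M) = x \<cdot> left_word M \<and> path_act A x (right_path A M) = x \<cdot> right_word M"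
    if "is_horn f (x, M)" for x M
  proof -
    have M: "\<forall>(a, b, d) \<in> set M. (a, b) \<in> Eq f \<and> d \<in> {- 1, 1}" and x: "x \<in> carrier A"
      using that by (auto simp: is_horn_def)
    have "\<forall>(a, b, d) \<in> set M. a \<in> carrier A \<and> b \<in> carrier A \<and> d \<in> {- 1, 1}"
      using M by (auto simp: Eq_def)
    from A.horn_paths[OF this] show ?thesis
      using horn_symmetric_words[OF M] x by (simp add: A.path_act_class)
  qed
  show ?thesis unfolding C1_eq_horn_endpoints
  proof
    assume "(a, b) \<in> horn_endpoints f"
    then obtain x u v where x: "x \<in> carrier A" and uv: "(u, v) \<in> symmetric_words f"
      and ab: "a = x \<cdot> u" "b = x \<cdot> v" by (elim horn_endpointsE)
    obtain M where M: "\<forall>(a, b, d) \<in> set M. (a, b) \<in> Eq f \<and> d \<in> {- 1, 1}"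
      "left_word M = u" "right_word M = v" using symmetric_words_horn[OF uv] by blast
    have "is_horn f (x, M)" using x M(1) by (simp add: is_horn_def)
    then show "\<exists>x M. is_horn f (x, M) \<and> path_act A x (left_path A M) = a \<and>
        path_act A x (right_path A M) = b"
      using ends[of x M] M(2,3) ab by blast
  next
    assume "\<exists>x M. is_horn f (x, M) \<and> path_act A x (left_path A M) = a \<and>
        path_act A x (right_path A M) = b"
    then obtain x M where h: "is_horn f (x, M)"
      and ab: "path_act A x (left_path A M) = a" "path_act A x (right_path A M) = b" by blast
    have "x \<in> carrier A" using h by (simp add: is_horn_def)
    from horn_endpointsI[OF this conjunct1[OF ends[OF h]]]
    show "(a, b) \<in> horn_endpoints f" using ends[OF h] ab by simp
  qed
qed

text \<open>A horn with endpoints \<open>x \<cdot> u\<close> and \<open>x \<cdot> v\<close> gives the symmetric path \<open>u\<inverse> v\<close> from the first to the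
  second; conversely a symmetric path \<open>u v\<inverse>\<close> from \<open>a\<close> to \<open>b\<close> gives the horn at \<open>a\<close> with sides
  \<open>u v\<inverse>\<close> and \<open>v v\<inverse>\<close>, the latter returning to \<open>a\<close>.\<close>

lemma C1_eq_orbits: "C1 f = orbit_rel A (symmetric_paths f)"
  unfolding C1_eq_horn_endpoints symmetric_paths_eq
proof (intro equalityI subrelI)
  fix a b assume ab: "(a, b) \<in> horn_endpoints f"
  then obtain x u v where x: "x \<in> carrier A" and uv: "(u, v) \<in> symmetric_words f"
    and w: "u \<in> words A" "v \<in> words A" and e: "a = x \<cdot> u" "b = x \<cdot> v" by (elim horn_endpointsE)
  have c: "a \<in> carrier A" "b \<in> carrier A"
    using x w by (simp_all add: e word_act_closed[OF A.rack_axioms])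
  let ?g = "path (word_inv u @ word_inv (word_inv v))"
  have "?g \<in> symmetric_quotients"
    by (intro symmetric_quotientsI symmetric_words_inv uv)
  moreover have "path_act A a ?g = b"
    using c(1) w by (simp add: A.path_act_class word_inv_words)
      (simp add: word_act_append e A.word_act_inv x)
  ultimately show "(a, b) \<in> orbit_rel A symmetric_quotients"
    using c unfolding orbit_rel_def by blast
next
  fix a b assume "(a, b) \<in> orbit_rel A symmetric_quotients"
  then obtain u v where a: "a \<in> carrier A" and uv: "(u, v) \<in> symmetric_words f"
    and b: "b = path_act A a (path (u @ word_inv v))"
    by (auto simp: orbit_rel_def symmetric_quotients_def)
  note w = symmetric_words_words[OF uv]
  have v: "word_inv v \<in> words A" using w by (simp add: word_inv_words)
  have "(u @ word_inv v, v @ word_inv v) \<in> symmetric_words f"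
    by (intro symmetric_words_append uv symmetric_words_refl v)
  then have "(a \<cdot> (u @ word_inv v), a \<cdot> (v @ word_inv v)) \<in> horn_endpoints f"
    by (rule horn_endpointsI[OF a])
  moreover have "a \<cdot> (u @ word_inv v) = b" using a v w by (simp add: b A.path_act_class)
  moreover have "a \<cdot> (v @ word_inv v) = a" using a w by (simp add: word_act_append A.word_act_inv)
  ultimately show "(a, b) \<in> horn_endpoints f"
    using equiv_sym_on[OF horn_endpoints_equiv] by (simp add: symD)
qed

end

section \<open>Quotients of racks\<close>

lemma rack_hom_extensional: "h \<in> rack_hom X Y \<Longrightarrow> h \<in> extensional (carrier X)"
  by (auto simp: rack_hom_def PiE_def)

lemma rack_hom_funcset: "h \<in> rack_hom X Y \<Longrightarrow> h \<in> carrier X \<rightarrow> carrier Y"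
  by (auto simp: rack_hom_def)

lemma rack_homI:
  assumes "h \<in> extensional (carrier X)" "\<And>x. x \<in> carrier X \<Longrightarrow> h x \<in> carrier Y"
    and "\<And>x y. x \<in> carrier X \<Longrightarrow> y \<in> carrier X \<Longrightarrow> h (x \<triangleleft>\<^bsub>X\<^esub> y) = h x \<triangleleft>\<^bsub>Y\<^esub> h y"
    and "\<And>x y. x \<in> carrier X \<Longrightarrow> y \<in> carrier X \<Longrightarrow> h (x \<triangleleft>\<inverse>\<^bsub>X\<^esub> y) = h x \<triangleleft>\<inverse>\<^bsub>Y\<^esub> h y"
  shows "h \<in> rack_hom X Y"
  using assms by (auto simp: rack_hom_def PiE_def)

lemma (in rack) rack_hom_id: "(\<lambda>x \<in> carrier X. x) \<in> rack_hom X X"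
  by (rule rack_homI) (auto simp: op_closed inv_closed)

lemma (in rack) rack_hom_compose:
  assumes "h \<in> rack_hom X Y" "k \<in> rack_hom Y Z"
  shows "compose (carrier X) k h \<in> rack_hom X Z"
  by (rule rack_homI)
    (auto simp: compose_eq op_closed inv_closed rack_hom_op[OF assms(1)] rack_hom_op[OF assms(2)]
      rack_hom_inv[OF assms(1)] rack_hom_inv[OF assms(2)] rack_hom_closed[OF assms(1)]
      rack_hom_closed[OF assms(2)])

locale quotient_of_rack = rack +
  fixes R :: "('a \<times> 'a) set"
  assumes congruence: "rack_congruence X R"
begin

abbreviation Q where "Q \<equiv> quotient_rack X R"

abbreviation cls where "cls x \<equiv> R `` {x}"

lemma R_equiv: "equiv (carrier X) R"
  using congruence by (simp add: rack_congruence_def)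

lemma R_op: "(x, x') \<in> R \<Longrightarrow> (y, y') \<in> R \<Longrightarrow> (x \<triangleleft> y, x' \<triangleleft> y') \<in> R"
  and R_inv: "(x, x') \<in> R \<Longrightarrow> (y, y') \<in> R \<Longrightarrow> (x \<triangleleft>\<inverse> y, x' \<triangleleft>\<inverse> y') \<in> R"
  using congruence unfolding rack_congruence_def by blast+

lemma Q_carrier: "carrier Q = cls ` carrier X"
  by (auto simp: quotient_rack_def quotient_def)

lemma Q_op:
  assumes "x \<in> carrier X" "y \<in> carrier X"
  shows "cls x \<triangleleft>\<^bsub>Q\<^esub> cls y = cls (x \<triangleleft> y)"
proof -
  have "congruent2 R R (\<lambda>x y. cls (x \<triangleleft> y))"
    by (auto simp: congruent2_def intro!: equiv_class_eq[OF R_equiv] R_op)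
  from UN_equiv_class2[OF R_equiv R_equiv this assms] show ?thesis
    by (simp add: quotient_rack_def)
qed

lemma Q_inv:
  assumes "x \<in> carrier X" "y \<in> carrier X"
  shows "cls x \<triangleleft>\<inverse>\<^bsub>Q\<^esub> cls y = cls (x \<triangleleft>\<inverse> y)"
proof -
  have "congruent2 R R (\<lambda>x y. cls (x \<triangleleft>\<inverse> y))"
    by (auto simp: congruent2_def intro!: equiv_class_eq[OF R_equiv] R_inv)
  from UN_equiv_class2[OF R_equiv R_equiv this assms] show ?thesis
    by (simp add: quotient_rack_def)
qed

lemma rack_Q: "rack Q"
  by unfold_locales
    (auto simp: Q_carrier Q_op Q_inv op_closed inv_closed op_inv inv_op simp flip: self_distrib)

lemma quotient_map_app: "x \<in> carrier X \<Longrightarrow> quotient_map X R x = cls x"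
  by (simp add: quotient_map_def)

lemma quotient_map_hom: "quotient_map X R \<in> rack_hom X Q"
  by (rule rack_homI) (auto simp: quotient_map_def Q_carrier Q_op Q_inv op_closed inv_closed)

lemma quotient_map_epi:
  assumes "h \<in> rack_hom Q Y" "k \<in> rack_hom Q Y"
    and "compose (carrier X) h (quotient_map X R) = compose (carrier X) k (quotient_map X R)"
  shows "h = k"
proof (rule extensionalityI[OF rack_hom_extensional[OF assms(1)] rack_hom_extensional[OF assms(2)]])
  fix C assume "C \<in> carrier Q"
  then obtain x where x: "x \<in> carrier X" "C = cls x" by (auto simp: Q_carrier)
  show "h C = k C" using fun_cong[OF assms(3), of x] x by (simp add: compose_eq quotient_map_app)
qed

lemma quotient_factorization:
  assumes h: "h \<in> rack_hom X Y" and R: "\<And>x x'. (x, x') \<in> R \<Longrightarrow> h x = h x'"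
  shows "\<exists>!k. k \<in> rack_hom Q Y \<and> compose (carrier X) k (quotient_map X R) = h"
proof -
  define k where "k = (\<lambda>C \<in> carrier Q. h (SOME x. x \<in> C))"
  have k: "k (cls x) = h x" if x: "x \<in> carrier X" for x
  proof -
    have "(SOME y. y \<in> cls x) \<in> cls x"
      by (rule someI[of "\<lambda>y. y \<in> cls x"]) (rule equiv_class_self[OF R_equiv x])
    then have "h x = h (SOME y. y \<in> cls x)" by (intro R) simp
    then show ?thesis using x by (simp add: k_def Q_carrier)
  qed
  have "k \<in> rack_hom Q Y"
  proof (rule rack_homI)
    show "k \<in> extensional (carrier Q)" by (simp add: k_def)
  qed (auto simp: Q_carrier Q_op Q_inv k op_closed inv_closed rack_hom_closed[OF h]
      rack_hom_op[OF h] rack_hom_inv[OF h])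
  moreover have "compose (carrier X) k (quotient_map X R) = h"
    using rack_hom_extensional[OF h]
    by (intro extensionalityI[of _ "carrier X"]) (simp_all add: compose_eq quotient_map_app k)
  ultimately show ?thesis using quotient_map_epi by blast
qed

end

section \<open>The category of extensions\<close>

lemma ext_homD:
  assumes "\<alpha> \<in> ext_hom f g"
  shows "fst \<alpha> \<in> rack_hom (src f) (src g)" "snd \<alpha> \<in> rack_hom (tgt f) (tgt g)"
    and "x \<in> carrier (src f) \<Longrightarrow> arr g (fst \<alpha> x) = snd \<alpha> (arr f x)"
proof -
  obtain \<alpha>1 \<alpha>0 where a: "\<alpha> = (\<alpha>1, \<alpha>0)" by force
  show "fst \<alpha> \<in> rack_hom (src f) (src g)" "snd \<alpha> \<in> rack_hom (tgt f) (tgt g)"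
    using assms by (auto simp: ext_hom_def a)
  have "compose (carrier (src f)) (arr g) \<alpha>1 = compose (carrier (src f)) \<alpha>0 (arr f)"
    using assms by (simp add: ext_hom_def a)
  from fun_cong[OF this, of x]
  show "x \<in> carrier (src f) \<Longrightarrow> arr g (fst \<alpha> x) = snd \<alpha> (arr f x)"
    by (simp add: compose_eq a)
qed

lemma ext_homI:
  assumes "\<alpha>1 \<in> rack_hom (src f) (src g)" "\<alpha>0 \<in> rack_hom (tgt f) (tgt g)"
    and "\<And>x. x \<in> carrier (src f) \<Longrightarrow> arr g (\<alpha>1 x) = \<alpha>0 (arr f x)"
  shows "(\<alpha>1, \<alpha>0) \<in> ext_hom f g"
  using assms by (auto simp: ext_hom_def compose_def)

lemma compose_id_right: "h \<in> extensional S \<Longrightarrow> compose S h (\<lambda>x \<in> S. x) = h"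
  by (auto simp: compose_def extensional_def fun_eq_iff)

lemma rack_hom_compose_id_left: "h \<in> rack_hom X Y \<Longrightarrow> compose (carrier X) (\<lambda>y \<in> carrier Y. y) h = h"
  using rack_hom_closed[of h X Y] rack_hom_extensional[of h X Y]
  by (auto simp: compose_def extensional_def fun_eq_iff)

lemma ext_comp_id_left: "\<alpha> \<in> ext_hom f g \<Longrightarrow> ext_comp f (ext_id g) \<alpha> = \<alpha>"
  by (simp add: ext_comp_def ext_id_def rack_hom_compose_id_left[OF ext_homD(1)]
      rack_hom_compose_id_left[OF ext_homD(2)])

lemma ext_comp_id_right: "\<alpha> \<in> ext_hom f g \<Longrightarrow> ext_comp f \<alpha> (ext_id f) = \<alpha>"
  by (simp add: ext_comp_def ext_id_def compose_id_right rack_hom_extensional[OF ext_homD(1)]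
      rack_hom_extensional[OF ext_homD(2)])

lemma ext_comp_assoc:
  assumes "\<alpha> \<in> ext_hom f g"
  shows "ext_comp f \<gamma> (ext_comp f \<beta> \<alpha>) = ext_comp f (ext_comp g \<gamma> \<beta>) \<alpha>"
  using ext_homD(1,2)[OF assms, THEN rack_hom_funcset]
  by (simp add: ext_comp_def compose_assoc)

context rack_extension
begin

lemma ext_id_hom: "ext_id f \<in> ext_hom f f"
  unfolding ext_id_def by (rule ext_homI) (simp_all add: A.rack_hom_id B.rack_hom_id arr_closed)

lemma ext_comp_hom:
  assumes "\<alpha> \<in> ext_hom f g" "\<beta> \<in> ext_hom g h"
  shows "ext_comp f \<beta> \<alpha> \<in> ext_hom f h"
  unfolding ext_comp_def
  using rack_hom_closed[OF ext_homD(1)[OF assms(1)]] ext_homD(3)[OF assms(1)] ext_homD(3)[OF assms(2)]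
  by (intro ext_homI A.rack_hom_compose[OF ext_homD(1)[OF assms(1)] ext_homD(1)[OF assms(2)]]
      B.rack_hom_compose[OF ext_homD(2)[OF assms(1)] ext_homD(2)[OF assms(2)]])
    (simp add: compose_eq arr_closed)

end

section \<open>The centralization and its universal property\<close>

context rack_extension
begin

sublocale C1: quotient_of_rack A "C1 f"
  by unfold_locales (rule C1_congruence)

lemma F1_factorization:
  "\<exists>!h. h \<in> rack_hom (F1i f) B \<and> compose (carrier A) h (eta1_top f) = arr f"
  unfolding F1i_def eta1_top_def
  using C1_subset_Eq by (intro C1.quotient_factorization arr_hom) (auto simp: Eq_def)

lemma F1_simps [simp]: "src (F1 f) = F1i f" "tgt (F1 f) = B"
  by (simp_all add: F1_def)

lemma F1_arr_hom: "arr (F1 f) \<in> rack_hom (F1i f) B"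
  and F1_arr_eta: "compose (carrier A) (arr (F1 f)) (eta1_top f) = arr f"
  using theI'[OF F1_factorization] by (simp_all add: F1_def)

lemma eta1_top_app: "x \<in> carrier A \<Longrightarrow> eta1_top f x = C1.cls x"
  by (simp add: eta1_top_def C1.quotient_map_app)

lemma F1i_carrier: "carrier (F1i f) = C1.cls ` carrier A"
  unfolding F1i_def by (rule C1.Q_carrier)

lemma F1_arr_cls: "x \<in> carrier A \<Longrightarrow> arr (F1 f) (C1.cls x) = arr f x"
  using fun_cong[OF F1_arr_eta, of x] by (simp add: compose_eq eta1_top_app)

lemma eta1_hom: "eta1 f \<in> ext_hom f (F1 f)"
  unfolding eta1_def
  by (rule ext_homI)
    (simp_all add: eta1_top_app F1_arr_cls arr_closed B.rack_hom_id C1.quotient_map_hom[folded eta1_top_def F1i_def])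

lemma F1_covering: "covering (F1 f)"
proof -
  have "extension (F1 f)"
    using F1_arr_hom arr_surj C1.rack_Q
    by (auto simp: extension_def F1i_carrier F1_arr_cls image_image B.rack_axioms simp flip: F1i_def)
  moreover have "(C1.cls x \<triangleleft>\<^bsub>F1i f\<^esub> C1.cls a) \<triangleleft>\<inverse>\<^bsub>F1i f\<^esub> C1.cls b = C1.cls x"
    if "x \<in> carrier A" "a \<in> carrier A" "b \<in> carrier A" "arr f a = arr f b" for x a b
    using that equiv_class_eq[OF C1_equiv C1_pair[of x a b]]
    by (simp add: F1i_def C1.Q_op C1.Q_inv A.op_closed Eq_def)
  ultimately show ?thesis by (auto simp: covering_def Eq_def F1i_carrier F1_arr_cls)
qed

lemma eta1_double_extension: "double_extension f (F1 f) (eta1 f)"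
  unfolding double_extension_def
proof (intro conjI)
  show "fst (eta1 f) ` carrier A = carrier (src (F1 f))"
    by (simp add: eta1_def F1i_carrier eta1_top_app)
  show "snd (eta1 f) ` carrier B = carrier (tgt (F1 f))"
    by (simp add: eta1_def)
  show "(\<lambda>a. (arr f a, fst (eta1 f) a)) ` carrier A
      = carrier (fibre_product B (src (F1 f)) (snd (eta1 f)) (arr (F1 f)))"
    by (auto simp: eta1_def fibre_product_def F1i_carrier eta1_top_app F1_arr_cls arr_closed)
qed (rule eta1_hom)

text \<open>In a covering the image of a generating pair of \<open>C1 f\<close> collapses, so \<open>C1 f\<close> is contained in the
  kernel pair of the top component.\<close>

lemma covering_factorization:
  assumes g: "covering g" and \<alpha>: "\<alpha> \<in> ext_hom f g"
  shows "\<exists>!h. h \<in> rack_hom (F1i f) (src g) \<and> compose (carrier A) h (eta1_top f) = fst \<alpha>"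
  unfolding F1i_def eta1_top_def
proof (rule C1.quotient_factorization)
  note h = ext_homD(1)[OF \<alpha>]
  show "fst \<alpha> \<in> rack_hom A (src g)" by (rule h)
  let ?R = "{(x, y). x \<in> carrier A \<and> y \<in> carrier A \<and> fst \<alpha> x = fst \<alpha> y}"
  have "equiv (carrier A) ?R"
    by (rule equivI) (auto simp: refl_on_def sym_def trans_def)
  moreover have "C1_pairs \<subseteq> ?R"
  proof clarify
    fix x a b assume x: "x \<in> carrier A" and ab: "(a, b) \<in> Eq f"
    then have m: "a \<in> carrier A" "b \<in> carrier A" by (simp_all add: Eq_def)
    have "(fst \<alpha> a, fst \<alpha> b) \<in> Eq g"
      using ab m by (simp add: Eq_def rack_hom_closed[OF h] ext_homD(3)[OF \<alpha>])
    then have "(fst \<alpha> x \<triangleleft>\<^bsub>src g\<^esub> fst \<alpha> a) \<triangleleft>\<inverse>\<^bsub>src g\<^esub> fst \<alpha> b = fst \<alpha> x"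
      using g rack_hom_closed[OF h x] unfolding covering_def by blast
    then show "(x \<triangleleft>\<^bsub>A\<^esub> a) \<triangleleft>\<inverse>\<^bsub>A\<^esub> b \<in> carrier A \<and> x \<in> carrier A \<and>
        fst \<alpha> ((x \<triangleleft>\<^bsub>A\<^esub> a) \<triangleleft>\<inverse>\<^bsub>A\<^esub> b) = fst \<alpha> x"
      using x m by (simp add: A.op_closed A.inv_closed rack_hom_op[OF h] rack_hom_inv[OF h])
  qed
  ultimately have "C1 f \<subseteq> ?R" unfolding C1_def by (rule generated_equiv_least)
  then show "fst \<alpha> x = fst \<alpha> x'" if "(x, x') \<in> C1 f" for x x' using that by blast
qed

text \<open>Since the unit is the identity at the bottom, a factorization is determined by its top component
  and any factorization of the top component is automatically compatible with the bottom one.\<close>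

lemma factorization_ext_hom:
  assumes \<alpha>: "\<alpha> \<in> ext_hom f g" and h: "h \<in> rack_hom (F1i f) (src g)"
    and e: "compose (carrier A) h (eta1_top f) = fst \<alpha>"
  shows "(h, snd \<alpha>) \<in> ext_hom (F1 f) g" and "ext_comp f (h, snd \<alpha>) (eta1 f) = \<alpha>"
proof -
  have app: "h (C1.cls x) = fst \<alpha> x" if "x \<in> carrier A" for x
    using fun_cong[OF e, of x] that by (simp add: compose_eq eta1_top_app)
  show "(h, snd \<alpha>) \<in> ext_hom (F1 f) g"
    using h ext_homD(2)[OF \<alpha>]
    by (intro ext_homI) (auto simp: F1i_carrier F1_arr_cls app ext_homD(3)[OF \<alpha>])
  show "ext_comp f (h, snd \<alpha>) (eta1 f) = \<alpha>"
    by (simp add: ext_comp_def eta1_def e compose_id_right rack_hom_extensional[OF ext_homD(2)[OF \<alpha>]])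
qed

lemma F1_universal:
  assumes g: "covering g" and \<alpha>: "\<alpha> \<in> ext_hom f g"
  shows "\<exists>!\<beta>. \<beta> \<in> ext_hom (F1 f) g \<and> ext_comp f \<beta> (eta1 f) = \<alpha>"
proof (rule ex_ex1I)
  show "\<exists>\<beta>. \<beta> \<in> ext_hom (F1 f) g \<and> ext_comp f \<beta> (eta1 f) = \<alpha>"
    using covering_factorization[OF g \<alpha>] factorization_ext_hom[OF \<alpha>] by blast
  fix \<beta> \<gamma>
  assume b: "\<beta> \<in> ext_hom (F1 f) g \<and> ext_comp f \<beta> (eta1 f) = \<alpha>"
    and c: "\<gamma> \<in> ext_hom (F1 f) g \<and> ext_comp f \<gamma> (eta1 f) = \<alpha>"
  have *: "fst \<delta> \<in> rack_hom (F1i f) (src g) \<and> compose (carrier A) (fst \<delta>) (eta1_top f) = fst \<alpha>"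
    "snd \<delta> = snd \<alpha>"
    if d: "\<delta> \<in> ext_hom (F1 f) g \<and> ext_comp f \<delta> (eta1 f) = \<alpha>" for \<delta>
  proof -
    have "snd \<delta> \<in> extensional (carrier B)"
      using rack_hom_extensional[OF ext_homD(2)[OF conjunct1[OF d]]] by simp
    then show "fst \<delta> \<in> rack_hom (F1i f) (src g) \<and> compose (carrier A) (fst \<delta>) (eta1_top f) = fst \<alpha>"
      "snd \<delta> = snd \<alpha>"
      using ext_homD(1)[OF conjunct1[OF d]] conjunct2[OF d]
      by (auto simp: ext_comp_def eta1_def compose_id_right)
  qed
  show "\<beta> = \<gamma>"
    using covering_factorization[OF g \<alpha>] *[OF b] *[OF c] by (metis prod_eqI)
qed

end

section \<open>Functoriality and repleteness\<close>

text \<open>The action of \<open>F1\<close> on a morphism is the factorization of \<open>eta1 g \<circ> \<alpha>\<close>, whose codomain \<open>F1 g\<close> is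
  a covering.\<close>

lemma F1_map_factorization:
  assumes f: "extension f" and g: "extension g" and \<alpha>: "\<alpha> \<in> ext_hom f g"
  shows "\<exists>!h. h \<in> rack_hom (F1i f) (F1i g) \<and>
      compose (carrier (src f)) h (eta1_top f) = compose (carrier (src f)) (eta1_top g) (fst \<alpha>)"
    and "F1_map f g \<alpha> \<in> ext_hom (F1 f) (F1 g)"
    and "ext_comp f (F1_map f g \<alpha>) (eta1 f) = ext_comp f (eta1 g) \<alpha>"
proof -
  interpret f: rack_extension f by unfold_locales (rule f)
  interpret g: rack_extension g by unfold_locales (rule g)
  let ?\<alpha> = "ext_comp f (eta1 g) \<alpha>"
  have h: "?\<alpha> \<in> ext_hom f (F1 g)" by (rule f.ext_comp_hom[OF \<alpha> g.eta1_hom])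
  have fst_\<alpha>: "fst ?\<alpha> = compose (carrier (src f)) (eta1_top g) (fst \<alpha>)"
    by (simp add: ext_comp_def eta1_def)
  have snd_\<alpha>: "snd ?\<alpha> = snd \<alpha>"
    by (simp add: ext_comp_def eta1_def rack_hom_compose_id_left[OF ext_homD(2)[OF \<alpha>]])
  show ex: "\<exists>!h. h \<in> rack_hom (F1i f) (F1i g) \<and>
      compose (carrier (src f)) h (eta1_top f) = compose (carrier (src f)) (eta1_top g) (fst \<alpha>)"
    using f.covering_factorization[OF g.F1_covering h] by (simp add: fst_\<alpha>)
  have "F1i_map f g (fst \<alpha>) \<in> rack_hom (F1i f) (src (F1 g))"
    "compose (carrier (src f)) (F1i_map f g (fst \<alpha>)) (eta1_top f) = fst ?\<alpha>"
    using theI'[OF ex] by (simp_all add: F1i_map_def fst_\<alpha>)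
  from f.factorization_ext_hom[OF h this]
  show "F1_map f g \<alpha> \<in> ext_hom (F1 f) (F1 g)"
    and "ext_comp f (F1_map f g \<alpha>) (eta1 f) = ?\<alpha>"
    by (simp_all add: F1_map_def snd_\<alpha>)
qed

text \<open>The principle by which equations between values of \<open>F1_map\<close> are verified: compare after
  composing with the unit.\<close>

lemma F1_map_unique:
  assumes f: "extension f" and g: "extension g" and \<alpha>: "\<alpha> \<in> ext_hom f g"
    and \<beta>: "\<beta> \<in> ext_hom (F1 f) (F1 g)" "ext_comp f \<beta> (eta1 f) = ext_comp f (eta1 g) \<alpha>"
  shows "F1_map f g \<alpha> = \<beta>"
proof -
  interpret f: rack_extension f by unfold_locales (rule f)
  interpret g: rack_extension g by unfold_locales (rule g)
  from f.F1_universal[OF g.F1_covering f.ext_comp_hom[OF \<alpha> g.eta1_hom]]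
  show ?thesis using F1_map_factorization(2,3)[OF f g \<alpha>] \<beta> by blast
qed

lemma F1_map_id:
  assumes f: "extension f"
  shows "F1_map f f (ext_id f) = ext_id (F1 f)"
proof -
  interpret f: rack_extension f by unfold_locales (rule f)
  interpret F: rack_extension "F1 f"
    by unfold_locales (use f.F1_covering in \<open>simp add: covering_def\<close>)
  show ?thesis
    by (rule F1_map_unique[OF f f f.ext_id_hom F.ext_id_hom])
      (simp add: ext_comp_id_left[OF f.eta1_hom] ext_comp_id_right[OF f.eta1_hom])
qed

lemma F1_map_comp:
  assumes f: "extension f" and g: "extension g" and h: "extension h"
    and \<alpha>: "\<alpha> \<in> ext_hom f g" and \<beta>: "\<beta> \<in> ext_hom g h"
  shows "F1_map f h (ext_comp f \<beta> \<alpha>) = ext_comp (F1 f) (F1_map g h \<beta>) (F1_map f g \<alpha>)"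
proof -
  interpret f: rack_extension f by unfold_locales (rule f)
  interpret g: rack_extension g by unfold_locales (rule g)
  interpret F: rack_extension "F1 f"
    by unfold_locales (use f.F1_covering in \<open>simp add: covering_def\<close>)
  note F\<alpha> = F1_map_factorization(2,3)[OF f g \<alpha>] and F\<beta> = F1_map_factorization(2,3)[OF g h \<beta>]
  show ?thesis
  proof (rule F1_map_unique[OF f h f.ext_comp_hom[OF \<alpha> \<beta>] F.ext_comp_hom[OF F\<alpha>(1) F\<beta>(1)]])
    have "ext_comp f (ext_comp (F1 f) (F1_map g h \<beta>) (F1_map f g \<alpha>)) (eta1 f)
        = ext_comp f (F1_map g h \<beta>) (ext_comp f (eta1 g) \<alpha>)"
      by (simp add: F\<alpha>(2) flip: ext_comp_assoc[OF f.eta1_hom])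
    also have "\<dots> = ext_comp f (ext_comp g (eta1 h) \<beta>) \<alpha>"
      by (simp add: F\<beta>(2) ext_comp_assoc[OF \<alpha>])
    finally show "ext_comp f (ext_comp (F1 f) (F1_map g h \<beta>) (F1_map f g \<alpha>)) (eta1 f)
        = ext_comp f (eta1 h) (ext_comp f \<beta> \<alpha>)"
      by (simp add: ext_comp_assoc[OF \<alpha>])
  qed
qed

text \<open>The covering identity of \<open>g\<close> is transported along \<open>\<beta>\<close> to \<open>f\<close>, where it holds,
  and back along \<open>\<alpha>\<close>.\<close>

lemma covering_replete:
  assumes f: "covering f" and g: "extension g" and "ext_isomorphic f g"
  shows "covering g"
proof -
  obtain \<alpha> \<beta> where \<alpha>: "\<alpha> \<in> ext_hom f g" and \<beta>: "\<beta> \<in> ext_hom g f"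
    and e: "ext_comp g \<alpha> \<beta> = ext_id g"
    using assms(3) unfolding ext_isomorphic_def by blast
  interpret g: rack_extension g by unfold_locales (rule g)
  note a = ext_homD(1)[OF \<alpha>] and b = ext_homD(1)[OF \<beta>]
  have ab: "fst \<alpha> (fst \<beta> x) = x" if "x \<in> carrier (src g)" for x
    using fun_cong[OF arg_cong[OF e, of fst], of x] that
    by (simp add: ext_comp_def ext_id_def compose_eq)
  have "(x \<triangleleft>\<^bsub>src g\<^esub> c) \<triangleleft>\<inverse>\<^bsub>src g\<^esub> d = x" if x: "x \<in> carrier (src g)" and cd: "(c, d) \<in> Eq g" for x c d
  proof -
    have m: "c \<in> carrier (src g)" "d \<in> carrier (src g)" using cd by (simp_all add: Eq_def)
    have "(fst \<beta> c, fst \<beta> d) \<in> Eq f"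
      using cd by (simp add: Eq_def rack_hom_closed[OF b] ext_homD(3)[OF \<beta>])
    then have "(fst \<beta> x \<triangleleft>\<^bsub>src f\<^esub> fst \<beta> c) \<triangleleft>\<inverse>\<^bsub>src f\<^esub> fst \<beta> d = fst \<beta> x"
      using f rack_hom_closed[OF b x] unfolding covering_def by blast
    then have "fst \<beta> ((x \<triangleleft>\<^bsub>src g\<^esub> c) \<triangleleft>\<inverse>\<^bsub>src g\<^esub> d) = fst \<beta> x"
      using x m by (simp add: rack_hom_op[OF b] rack_hom_inv[OF b] g.A.op_closed)
    from arg_cong[OF this, of "fst \<alpha>"] show ?thesis
      using x m by (simp add: ab g.A.op_closed g.A.inv_closed)
  qed
  then show ?thesis using g by (auto simp: covering_def)
qed

theorem theorem3p4p0p1: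
  shows
    \<comment> \<open>the centralizing congruence and its descriptions; (i) is the definition of C1\<close>
    "(\<forall>f :: ('a, 'b) rack_arrow. extension f \<longrightarrow>
        rack_congruence (src f) (C1 f) \<and> C1 f \<subseteq> Eq f \<and>
        (\<forall>a \<in> carrier (src f). \<forall>b \<in> carrier (src f).
           (a, b) \<in> C1 f \<longleftrightarrow>
           (\<exists>x M. is_horn f (x, M) \<and> path_act (src f) x (left_path (src f) M) = a \<and>
                  path_act (src f) x (right_path (src f) M) = b)) \<and>
        C1 f = orbit_rel (src f) (kernel (Pth (src f)) (Pth (tgt f)) (Pth_map f)) \<and>
        C1 f = orbit_rel (src f) (symmetric_paths f) \<and>
        kernel (Pth (src f)) (Pth (tgt f)) (Pth_map f) = symmetric_paths f) \<and>
     \<comment> \<open>F1 on objects and the unit\<close>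
     (\<forall>f :: ('a, 'b) rack_arrow. extension f \<longrightarrow>
        (\<exists>!h. h \<in> rack_hom (F1i f) (tgt f) \<and>
              compose (carrier (src f)) h (eta1_top f) = arr f) \<and>
        central (F1 f) \<and> double_extension f (F1 f) (eta1 f)) \<and>
     \<comment> \<open>F1 on morphisms and naturality of the unit\<close>
     (\<forall>(f :: ('a, 'b) rack_arrow) (g :: ('c, 'd) rack_arrow).
        extension f \<longrightarrow> extension g \<longrightarrow> (\<forall>\<alpha> \<in> ext_hom f g.
          (\<exists>!h. h \<in> rack_hom (F1i f) (F1i g) \<and>
                compose (carrier (src f)) h (eta1_top f)
                  = compose (carrier (src f)) (eta1_top g) (fst \<alpha>)) \<and>
          F1_map f g \<alpha> \<in> ext_hom (F1 f) (F1 g) \<and>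
          ext_comp f (F1_map f g \<alpha>) (eta1 f) = ext_comp f (eta1 g) \<alpha>)) \<and>
     \<comment> \<open>functoriality of F1\<close>
     (\<forall>f :: ('a, 'b) rack_arrow. extension f \<longrightarrow> F1_map f f (ext_id f) = ext_id (F1 f)) \<and>
     (\<forall>(f :: ('a, 'b) rack_arrow) (g :: ('c, 'd) rack_arrow) (h :: ('e, 'h) rack_arrow).
        extension f \<longrightarrow> extension g \<longrightarrow> extension h \<longrightarrow>
        (\<forall>\<alpha> \<in> ext_hom f g. \<forall>\<beta> \<in> ext_hom g h.
           F1_map f h (ext_comp f \<beta> \<alpha>) = ext_comp (F1 f) (F1_map g h \<beta>) (F1_map f g \<alpha>))) \<and>
     \<comment> \<open>F1 is left adjoint to the (full) inclusion, with unit eta1\<close>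
     (\<forall>(f :: ('a, 'b) rack_arrow) (g :: ('c, 'd) rack_arrow).
        extension f \<longrightarrow> central g \<longrightarrow>
        (\<forall>\<alpha> \<in> ext_hom f g. \<exists>!\<beta>. \<beta> \<in> ext_hom (F1 f) g \<and> ext_comp f \<beta> (eta1 f) = \<alpha>)) \<and>
     \<comment> \<open>repleteness\<close>
     (\<forall>(f :: ('a, 'b) rack_arrow) (g :: ('c, 'd) rack_arrow).
        central f \<longrightarrow> extension g \<longrightarrow> ext_isomorphic f g \<longrightarrow> central g)"
proof (intro conjI allI impI ballI)
  fix f :: "('a, 'b) rack_arrow" assume "extension f"
  then interpret rack_extension f by unfold_locales
  show "rack_congruence (src f) (C1 f)" by (rule C1_congruence)
  show "C1 f \<subseteq> Eq f" by (rule C1_subset_Eq)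
  show "(a, b) \<in> C1 f \<longleftrightarrow>
      (\<exists>x M. is_horn f (x, M) \<and> path_act (src f) x (left_path (src f) M) = a \<and>
             path_act (src f) x (right_path (src f) M) = b)" for a b
    by (rule C1_iff_horn)
  show "C1 f = orbit_rel (src f) (kernel (Pth (src f)) (Pth (tgt f)) (Pth_map f))"
    by (simp add: kernel_eq_symmetric_paths C1_eq_orbits)
  show "C1 f = orbit_rel (src f) (symmetric_paths f)" by (rule C1_eq_orbits)
  show "kernel (Pth (src f)) (Pth (tgt f)) (Pth_map f) = symmetric_paths f"
    by (rule kernel_eq_symmetric_paths)
  show "\<exists>!h. h \<in> rack_hom (F1i f) (tgt f) \<and> compose (carrier (src f)) h (eta1_top f) = arr f"
    by (rule F1_factorization)
  show "central (F1 f)" using F1_covering by (simp add: central_iff_covering)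
  show "double_extension f (F1 f) (eta1 f)" by (rule eta1_double_extension)
  show "F1_map f f (ext_id f) = ext_id (F1 f)" by (rule F1_map_id[OF extension_f])
next
  fix f :: "('a, 'b) rack_arrow" and g :: "('c, 'd) rack_arrow" and \<alpha>
  assume fg: "extension f" "extension g" "\<alpha> \<in> ext_hom f g"
  show "\<exists>!h. h \<in> rack_hom (F1i f) (F1i g) \<and>
      compose (carrier (src f)) h (eta1_top f) = compose (carrier (src f)) (eta1_top g) (fst \<alpha>)"
    and "F1_map f g \<alpha> \<in> ext_hom (F1 f) (F1 g)"
    and "ext_comp f (F1_map f g \<alpha>) (eta1 f) = ext_comp f (eta1 g) \<alpha>"
    by (rule F1_map_factorization[OF fg])+
next
  fix f :: "('a, 'b) rack_arrow" and g :: "('c, 'd) rack_arrow" and h :: "('e, 'h) rack_arrow"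
    and \<alpha> \<beta>
  assume "extension f" "extension g" "extension h" "\<alpha> \<in> ext_hom f g" "\<beta> \<in> ext_hom g h"
  then show "F1_map f h (ext_comp f \<beta> \<alpha>) = ext_comp (F1 f) (F1_map g h \<beta>) (F1_map f g \<alpha>)"
    by (rule F1_map_comp)
next
  fix f :: "('a, 'b) rack_arrow" and g :: "('c, 'd) rack_arrow" and \<alpha>
  assume f: "extension f" and g: "central g" and \<alpha>: "\<alpha> \<in> ext_hom f g"
  interpret rack_extension f by unfold_locales (rule f)
  show "\<exists>!\<beta>. \<beta> \<in> ext_hom (F1 f) g \<and> ext_comp f \<beta> (eta1 f) = \<alpha>"
    using g \<alpha> by (intro F1_universal) (simp_all add: central_iff_covering)
next
  fix f :: "('a, 'b) rack_arrow" and g :: "('c, 'd) rack_arrow"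
  assume "central f" "extension g" "ext_isomorphic f g"
  then show "central g" unfolding central_iff_covering by (rule covering_replete)
qed

end
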